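(* Let $E$ be a finite set, $\mathbb{I}=(S,(R_e)_{e\in E})$ a finite $E$-graph (the constraint graph), $\mathbb{G}$ a finite $E$-group that is compatible with $\mathbb{I}$, and $N\ge2$. Then there is a finite $E$-group $\hat{\mathbb{G}}\succeq\mathbb{G}$ (hence also compatible with $\mathbb{I}$) that is $N$-acyclic over $\mathbb{I}$ and such that every $\rho\in\mathrm{Sym}(E)$ which is simultaneously a symmetry of $\mathbb{I}$ and a symmetry of $\mathbb{G}$ is also a symmetry of $\hat{\mathbb{G}}$.
   Context: Let $E$ be a finite set. An $E$-group is a group $\mathbb{G}$ together with an inclusion $E\subseteq\mathbb{G}$ such that $E$ generates $\mathbb{G}$ and every $e\in E$ satisfies $e\neq1$, $e^2=1$. For $w=e_1\cdots e_n\in E^*$ write $[w]_{\mathbb{G}}=e_1\cdots e_n$. A homomorphism of $E$-groups is a group homomorphism fixing each $e\in E$; $\hat{\mathbb{G}}\succeq\mathbb{G}$ means such a homomorphism $\hat{\mathbb{G}}\to\mathbb{G}$ exists. An $E$-graph is a structure $\mathbb{H}=(V,(R_e)_{e\in E})$ where each $R_e\subseteq V\times V$ is symmetric and every vertex has at most one $R_e$-neighbour (loops allowed). For $e\in E$ let $\pi_e$ be the permutation of $V$ swapping each vertex with its $R_e$-neighbour if it has one and fixing it otherwise, and for $w=e_1\cdots e_n$ let $\pi_w=\pi_{e_n}\circ\cdots\circ\pi_{e_1}$. An $E$-group $\mathbb{G}$ is compatible with $\mathbb{H}$ if for every $w\in E^*$, $[w]_{\mathbb{G}}=1$ implies $\pi_w=\mathrm{id}_V$.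 For the constraint graph $\mathbb{I}=(S,(R_e))$, $\alpha\subseteq E$ and $s,t\in S$: $\alpha^*[\mathbb{I},s]$ is the set of words $w=e_1\cdots e_n\in\alpha^*$ that label a walk in $\mathbb{I}$ from $s$ (i.e. there are $s=s_0,\dots,s_n$ with $(s_{i-1},s_i)\in R_{e_i}$), and $\alpha^*[\mathbb{I},s,t]$ those labelling such a walk ending in $s_n=t$. For $g\in\mathbb{G}$ the $\mathbb{I}$-coset is $C[\mathbb{I},\alpha,s;g]:=\{g[w]_{\mathbb{G}}: w\in\alpha^*[\mathbb{I},s]\}$. An $\mathbb{I}$-coset cycle of length $n\ge2$ is a cyclically indexed family $(g_i,\alpha_i,s_i)_{i\in\mathbb{Z}_n}$ with $g_i\in\mathbb{G}$, $\alpha_i\subsetneq E$, $s_i\in S$ such that for all $i$: (connectivity) $g_{i+1}=g_i[w]_{\mathbb{G}}$ for some $w\in\alpha_i^*[\mathbb{I},s_i,s_{i+1}]$; (separation) $C[\mathbb{I},\alpha_i\cap\alpha_{i-1},s_i;g_i]\cap C[\mathbb{I},\alpha_i\cap\alpha_{i+1},s_{i+1};g_{i+1}]=\emptyset$. An $E$-group compatible with $\mathbb{I}$ is $N$-acyclic over $\mathbb{I}$ if it admits no $\mathbb{I}$-coset cycle of length $n$ with $2\le n\le N$. $\rho\in\mathrm{Sym}(E)$ is a symmetry of the $E$-group $\mathbb{G}$ if some group automorphism $\varphi$ of $\mathbb{G}$ satisfies $\varphi(e)=\rho(e)$ for all $e\in E$; it is a symmetry of the $E$-graph $\mathbb{I}$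 if there is a bijection $f:S\to S$ with $(s,t)\in R_e\Leftrightarrow(f(s),f(t))\in R_{\rho(e)}$ for all $e,s,t$. *)

theory Defs
  imports "HOL-Algebra.Algebra" "HOL-Combinatorics.Permutations"
begin

definition E_group :: "'e set \<Rightarrow> ('g, 'b) monoid_scheme \<Rightarrow> ('e \<Rightarrow> 'g) \<Rightarrow> bool" where
  "E_group E G \<iota> \<longleftrightarrow> group G \<and> \<iota> ` E \<subseteq> carrier G \<and> inj_on \<iota> E \<and>
     (\<forall>e\<in>E. \<iota> e \<noteq> \<one>\<^bsub>G\<^esub> \<and> \<iota> e \<otimes>\<^bsub>G\<^esub> \<iota> e = \<one>\<^bsub>G\<^esub>) \<and>
     generate G (\<iota> ` E) = carrier G"

definition wval :: "('g, 'b) monoid_scheme \<Rightarrow> ('e \<Rightarrow> 'g) \<Rightarrow> 'e list \<Rightarrow> 'g" where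
  "wval G \<iota> w = foldr (\<lambda>e acc. \<iota> e \<otimes>\<^bsub>G\<^esub> acc) w \<one>\<^bsub>G\<^esub>"

definition E_hom_exists ::
  "'e set \<Rightarrow> ('h, 'c) monoid_scheme \<Rightarrow> ('e \<Rightarrow> 'h) \<Rightarrow> ('g, 'b) monoid_scheme \<Rightarrow> ('e \<Rightarrow> 'g) \<Rightarrow> bool" where
  "E_hom_exists E H \<kappa> G \<iota> \<longleftrightarrow> (\<exists>h \<in> hom H G. \<forall>e\<in>E. h (\<kappa> e) = \<iota> e)"

definition E_graph :: "'e set \<Rightarrow> 'v set \<Rightarrow> ('e \<Rightarrow> ('v \<times> 'v) set) \<Rightarrow> bool" where
  "E_graph E V R \<longleftrightarrow> (\<forall>e\<in>E. R e \<subseteq> V \<times> V \<and> sym (R e) \<and>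
     (\<forall>v u u'. (v, u) \<in> R e \<and> (v, u') \<in> R e \<longrightarrow> u = u'))"

definition pi_e :: "('e \<Rightarrow> ('v \<times> 'v) set) \<Rightarrow> 'e \<Rightarrow> 'v \<Rightarrow> 'v" where
  "pi_e R e v = (if \<exists>u. (v, u) \<in> R e then (THE u. (v, u) \<in> R e) else v)"

text \<open>pi_w = pi_en o ... o pi_e1 (e1 applied first).\<close>

definition pi_w :: "('e \<Rightarrow> ('v \<times> 'v) set) \<Rightarrow> 'e list \<Rightarrow> 'v \<Rightarrow> 'v" where
  "pi_w R w = fold (\<lambda>e f. pi_e R e \<circ> f) w id"

definition compatible ::
  "'e set \<Rightarrow> 'v set \<Rightarrow> ('e \<Rightarrow> ('v \<times> 'v) set) \<Rightarrow> ('g, 'b) monoid_scheme \<Rightarrow> ('e \<Rightarrow> 'g) \<Rightarrow> bool" where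
  "compatible E V R G \<iota> \<longleftrightarrow>
     (\<forall>w. set w \<subseteq> E \<and> wval G \<iota> w = \<one>\<^bsub>G\<^esub> \<longrightarrow> (\<forall>v\<in>V. pi_w R w v = v))"

fun walk :: "('e \<Rightarrow> ('v \<times> 'v) set) \<Rightarrow> 'v \<Rightarrow> 'e list \<Rightarrow> 'v \<Rightarrow> bool" where
  "walk R s [] t \<longleftrightarrow> s = t"
| "walk R s (e # w) t \<longleftrightarrow> (\<exists>u. (s, u) \<in> R e \<and> walk R u w t)"

definition coset ::
  "('g, 'b) monoid_scheme \<Rightarrow> ('e \<Rightarrow> 'g) \<Rightarrow> ('e \<Rightarrow> ('v \<times> 'v) set) \<Rightarrow> 'e set \<Rightarrow> 'v \<Rightarrow> 'g \<Rightarrow> 'g set" where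
  "coset G \<iota> R \<alpha> s g = {g \<otimes>\<^bsub>G\<^esub> wval G \<iota> w | w. set w \<subseteq> \<alpha> \<and> (\<exists>t. walk R s w t)}"

definition coset_cycle ::
  "'e set \<Rightarrow> 'v set \<Rightarrow> ('e \<Rightarrow> ('v \<times> 'v) set) \<Rightarrow> ('g, 'b) monoid_scheme \<Rightarrow> ('e \<Rightarrow> 'g) \<Rightarrow>
   nat \<Rightarrow> (nat \<Rightarrow> 'g) \<Rightarrow> (nat \<Rightarrow> 'e set) \<Rightarrow> (nat \<Rightarrow> 'v) \<Rightarrow> bool" where
  "coset_cycle E V R G \<iota> n g \<alpha> s \<longleftrightarrow> n \<ge> 2 \<and>
     (\<forall>i<n. g i \<in> carrier G \<and> \<alpha> i \<subset> E \<and> s i \<in> V \<and>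
        (\<exists>w. set w \<subseteq> \<alpha> i \<and> walk R (s i) w (s ((i + 1) mod n)) \<and>
             g ((i + 1) mod n) = g i \<otimes>\<^bsub>G\<^esub> wval G \<iota> w) \<and>
        coset G \<iota> R (\<alpha> i \<inter> \<alpha> ((i + n - 1) mod n)) (s i) (g i) \<inter>
        coset G \<iota> R (\<alpha> i \<inter> \<alpha> ((i + 1) mod n)) (s ((i + 1) mod n)) (g ((i + 1) mod n)) = {})"

definition N_acyclic ::
  "nat \<Rightarrow> 'e set \<Rightarrow> 'v set \<Rightarrow> ('e \<Rightarrow> ('v \<times> 'v) set) \<Rightarrow> ('g, 'b) monoid_scheme \<Rightarrow> ('e \<Rightarrow> 'g) \<Rightarrow> bool" where
  "N_acyclic N E V R G \<iota> \<longleftrightarrow> compatible E V R G \<iota> \<and>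
     \<not> (\<exists>n g \<alpha> s. 2 \<le> n \<and> n \<le> N \<and> coset_cycle E V R G \<iota> n g \<alpha> s)"

definition group_symmetry ::
  "'e set \<Rightarrow> ('g, 'b) monoid_scheme \<Rightarrow> ('e \<Rightarrow> 'g) \<Rightarrow> ('e \<Rightarrow> 'e) \<Rightarrow> bool" where
  "group_symmetry E G \<iota> \<rho> \<longleftrightarrow> (\<exists>\<phi> \<in> iso G G. \<forall>e\<in>E. \<phi> (\<iota> e) = \<iota> (\<rho> e))"

definition graph_symmetry ::
  "'e set \<Rightarrow> 'v set \<Rightarrow> ('e \<Rightarrow> ('v \<times> 'v) set) \<Rightarrow> ('e \<Rightarrow> 'e) \<Rightarrow> bool" where
  "graph_symmetry E V R \<rho> \<longleftrightarrow> (\<exists>f. bij_betw f V V \<and>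
     (\<forall>e\<in>E. \<forall>s\<in>V. \<forall>t\<in>V. (s, t) \<in> R e \<longleftrightarrow> (f s, f t) \<in> R (\<rho> e)))"

end

theory Submission
  imports Defs
begin

text \<open>
  Write \<open>G[A]\<close> for the subgroup generated by the letters in \<open>A\<close>. The group is enlarged \<open>card E\<close> times,
  at level \<open>k\<close> to the permutation group generated by \<open>G\<close> and all bounded-size actions on which every
  word over at most \<open>k\<close> letters that is trivial in \<open>G\<close> acts trivially; this leaves \<open>G[A]\<close> unchanged for
  \<open>card A \<le> k\<close> and is invariant under the symmetries of \<open>G\<close>. Two kinds of actions are shown to be
  admitted. Chains of copies of \<open>G[A\<^sub>0]\<close>, \<open>G[A\<^sub>1]\<close>, \<open>\<dots>\<close> glued along cosets of
  \<open>G[A\<^sub>i \<inter> A\<^sub>i\<^sub>+\<^sub>1]\<close> exclude cycles of plain cosets. The constraint graph, completed for the letters of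
  a set \<open>A\<close>, ensures that walk-labelling words of the constraint graph that lie in \<open>G[A]\<close>, or in
  \<open>G[A] G[B]\<close>, are represented by words over \<open>A\<close>, or over \<open>A\<close> and then \<open>B\<close>, that again label walks.
  For a coset cycle over the constraint graph the former yields a member at which the plain cosets
  meet, and the latter moves the meeting point into the cosets over the constraint graph. Both kinds
  of actions restrict, for words over few letters, to actions of the same kind for smaller sets,
  which is why they are compatible by induction.\<close>

text \<open>The obstacle is a circularity: the chains and completions that the new group has to
  respect consist of copies of its own subgroups, so their size seems to depend on the group under
  construction. The levels remove it. At level \<open>k + 1\<close> only letter sets with at most
  \<open>k\<close> members occur; on these the new group agrees with its predecessor, so the
  structures already live over the predecessor and their size is bounded in advance.
  \<open>card E\<close> levels suffice because the letter sets of a coset cycle are proper subsets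
  of \<open>E\<close>.

  The restriction to fewer letters rests on a further invariant, \<open>retractable\<close>: erasing
  all letters outside a small set \<open>A\<close> keeps trivial words trivial. Hence an element
  with one word over \<open>A\<close> and another over \<open>B\<close> has one over
  \<open>A \<inter> B\<close>, which controls the overlaps. The invariant is passed on by a third
  kind of action, in which the letters of \<open>A\<close> multiply \<open>G\<close> and all others
  do nothing.\<close>

section \<open>Words and involutive actions\<close>

text \<open>Words act through \<open>fold\<close>, first letter first. This is a right action, in
  accordance with right multiplication by \<open>val u \<otimes> val v\<close> for
  \<open>u @ v\<close>; as letters are involutions, \<open>rev w\<close> undoes
  \<open>w\<close>.\<close>

definition acts :: "'e set \<Rightarrow> 'x set \<Rightarrow> ('e \<Rightarrow> 'x \<Rightarrow> 'x) \<Rightarrow> bool" where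
  "acts E V p \<longleftrightarrow> (\<forall>e\<in>E. \<forall>v\<in>V. p e v \<in> V \<and> p e (p e v) = v)"

lemma acts_mono: "acts E V p \<Longrightarrow> A \<subseteq> E \<Longrightarrow> acts A V p"
  by (auto simp: acts_def)

lemma acts_fold: "acts E V p \<Longrightarrow> set w \<subseteq> E \<Longrightarrow> v \<in> V \<Longrightarrow> fold p w v \<in> V"
  by (induction w arbitrary: v) (auto simp: acts_def)

lemma acts_fold_rev:
  "acts E V p \<Longrightarrow> set w \<subseteq> E \<Longrightarrow> v \<in> V \<Longrightarrow> fold p (rev w) (fold p w v) = v"
proof (induction w arbitrary: v)
  case (Cons e w)
  then have "p e v \<in> V" "p e (p e v) = v" by (auto simp: acts_def)
  with Cons show ?case by simp
qed simp

lemma acts_fold_rev':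
  "acts E V p \<Longrightarrow> set w \<subseteq> E \<Longrightarrow> v \<in> V \<Longrightarrow> fold p w (fold p (rev w) v) = v"
  using acts_fold_rev[of E V p "rev w" v] by simp

lemma fold_agree:
  assumes "\<And>e v. e \<in> set w \<Longrightarrow> v \<in> V \<Longrightarrow> p e v = q e v \<and> q e v \<in> V" and "v \<in> V"
  shows "fold p w v = fold q w v"
  using assms
proof (induction w arbitrary: v)
  case (Cons e w)
  then have "p e v = q e v" "q e v \<in> V" by auto
  then show ?case using Cons by simp
qed simp

lemma fold_filter:
  assumes "\<And>e v. e \<in> set w \<Longrightarrow> v \<in> V \<Longrightarrow> p e v \<in> V \<and> (e \<notin> A \<longrightarrow> p e v = v)" and "v \<in> V"
  shows "fold p w v = fold p (filter (\<lambda>e. e \<in> A) w) v"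
  using assms
proof (induction w arbitrary: v)
  case (Cons e w)
  then have "p e v \<in> V" "e \<notin> A \<longrightarrow> p e v = v" by auto
  then show ?case using Cons by simp
qed simp

lemma fold_map_letters: "fold p (map \<rho> w) v = fold (\<lambda>e. p (\<rho> e)) w v"
  by (induction w arbitrary: v) auto

lemma fold_conjugate:
  assumes "\<And>e v. e \<in> set w \<Longrightarrow> v \<in> V \<Longrightarrow> p e v \<in> V \<and> q e (h v) = h (p e v)" and "v \<in> V"
  shows "fold q w (h v) = h (fold p w v)"
  using assms
proof (induction w arbitrary: v)
  case (Cons e w)
  then have "p e v \<in> V" "q e (h v) = h (p e v)" by auto
  then show ?case using Cons by simp
qed simp

section \<open>Values of words in an E-group\<close>

locale egrp =
  fixes E :: "'e set" and G :: "('g, 'b) monoid_scheme" (structure) and \<iota> :: "'e \<Rightarrow> 'g"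
  assumes eg: "E_group E G \<iota>"
begin

sublocale group G
  using eg by (simp add: E_group_def)

abbreviation val :: "'e list \<Rightarrow> 'g" where "val \<equiv> wval G \<iota>"

lemma gen_closed: "e \<in> E \<Longrightarrow> \<iota> e \<in> carrier G"
  using eg by (auto simp: E_group_def)

lemma gen_sq: "e \<in> E \<Longrightarrow> \<iota> e \<otimes> \<iota> e = \<one>"
  using eg by (auto simp: E_group_def)

lemma val_Nil [simp]: "val [] = \<one>"
  by (simp add: wval_def)

lemma val_Cons [simp]: "val (e # w) = \<iota> e \<otimes> val w"
  by (simp add: wval_def)

lemma val_closed [simp]: "set w \<subseteq> E \<Longrightarrow> val w \<in> carrier G"
  by (induction w) (auto simp: gen_closed)

lemma val_append [simp]: "set u \<subseteq> E \<Longrightarrow> set v \<subseteq> E \<Longrightarrow> val (u @ v) = val u \<otimes> val v"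
  by (induction u) (auto simp: gen_closed m_assoc)

lemma inv_gen: "e \<in> E \<Longrightarrow> inv (\<iota> e) = \<iota> e"
  using gen_sq gen_closed by (metis inv_equality)

lemma val_rev: "set w \<subseteq> E \<Longrightarrow> val (rev w) = inv (val w)"
  by (induction w) (auto simp: gen_closed inv_gen inv_mult_group)

lemma val_eq_iff:
  assumes "set u \<subseteq> E" "set v \<subseteq> E"
  shows "val u = val v \<longleftrightarrow> val (u @ rev v) = \<one>"
proof -
  have "val (u @ rev v) = val u \<otimes> inv (val v)" using assms by (simp add: val_rev)
  then show ?thesis using assms
    by (metis inv_closed inv_equality inv_inv r_inv val_closed)
qed

lemma carrier_val: "carrier G = {val w | w. set w \<subseteq> E}"
proof
  have gen: "generate G (\<iota> ` E) = carrier G" using eg by (simp add: E_group_def)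
  show "carrier G \<subseteq> {val w | w. set w \<subseteq> E}"
  proof
    fix x assume "x \<in> carrier G"
    then have "x \<in> generate G (\<iota> ` E)" using gen by simp
    then show "x \<in> {val w | w. set w \<subseteq> E}"
    proof induction
      case one
      show ?case by (auto intro!: exI[of _ "[]"])
    next
      case (incl h)
      then obtain e where "e \<in> E" "h = \<iota> e" by auto
      then show ?case by (auto intro!: exI[of _ "[e]"] simp: gen_closed)
    next
      case (inv h)
      then obtain e where "e \<in> E" "h = \<iota> e" by auto
      then show ?case by (auto intro!: exI[of _ "[e]"] simp: gen_closed inv_gen)
    next
      case (eng h1 h2)
      then obtain u v where "set u \<subseteq> E" "set v \<subseteq> E" "h1 = val u" "h2 = val v" by auto
      then show ?case by (auto intro!: exI[of _ "u @ v"])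
    qed
  qed
qed auto

lemma fold_right_mult:
  "set w \<subseteq> E \<Longrightarrow> x \<in> carrier G \<Longrightarrow> fold (\<lambda>e x. x \<otimes> \<iota> e) w x = x \<otimes> val w"
  by (induction w arbitrary: x) (auto simp: gen_closed m_assoc)

lemma acts_right_mult: "acts E (carrier G) (\<lambda>e x. x \<otimes> \<iota> e)"
  by (auto simp: acts_def gen_closed m_assoc gen_sq)

lemma mult_eq_self: "x \<in> carrier G \<Longrightarrow> y \<in> carrier G \<Longrightarrow> x \<otimes> y = x \<longleftrightarrow> y = \<one>"
  by (metis l_cancel_one)

end

text \<open>If \<open>u\<close> and \<open>v\<close> have the same value in \<open>H\<close>, then
  \<open>u @ rev v\<close> is trivial there and hence in \<open>G\<close>, so the value in
  \<open>G\<close> depends only on the value in \<open>H\<close>. The target asks only for letters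
  that square to the identity, which suits the relabelled letters \<open>\<iota> (\<rho> e)\<close>
  as well.\<close>

lemma hom_of_words:
  assumes "E_group E H \<kappa>" and "group G" and "\<iota>' ` E \<subseteq> carrier G"
    and "\<And>e. e \<in> E \<Longrightarrow> \<iota>' e \<otimes>\<^bsub>G\<^esub> \<iota>' e = \<one>\<^bsub>G\<^esub>"
    and ker: "\<And>w. set w \<subseteq> E \<Longrightarrow> wval H \<kappa> w = \<one>\<^bsub>H\<^esub> \<Longrightarrow> wval G \<iota>' w = \<one>\<^bsub>G\<^esub>"
  obtains h where "h \<in> hom H G" "\<And>w. set w \<subseteq> E \<Longrightarrow> h (wval H \<kappa> w) = wval G \<iota>' w"
proof -
  interpret H: egrp E H \<kappa> by unfold_locales fact
  interpret G: group G by fact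
  have cl: "wval G \<iota>' w \<in> carrier G" if "set w \<subseteq> E" for w
    using that assms(3) by (induction w) (auto simp: wval_def)
  have app: "wval G \<iota>' (u @ v) = wval G \<iota>' u \<otimes>\<^bsub>G\<^esub> wval G \<iota>' v"
    if "set u \<subseteq> E" "set v \<subseteq> E" for u v
    using that(1)
  proof (induction u)
    case Nil
    show ?case using cl[OF that(2)] by (simp add: wval_def)
  next
    case (Cons e u)
    then have "\<iota>' e \<in> carrier G" "wval G \<iota>' u \<in> carrier G" "wval G \<iota>' v \<in> carrier G"
      using assms(3) cl that(2) by auto
    with Cons show ?case by (simp add: wval_def G.m_assoc)
  qed
  have rev1: "wval G \<iota>' w \<otimes>\<^bsub>G\<^esub> wval G \<iota>' (rev w) = \<one>\<^bsub>G\<^esub>" if "set w \<subseteq> E" for w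
    using that
  proof (induction w)
    case (Cons e w)
    then have c: "\<iota>' e \<in> carrier G" "wval G \<iota>' w \<in> carrier G" "wval G \<iota>' (rev w) \<in> carrier G"
      using assms(3) cl by auto
    have "wval G \<iota>' (e # w) = \<iota>' e \<otimes>\<^bsub>G\<^esub> wval G \<iota>' w" by (simp add: wval_def)
    moreover have "wval G \<iota>' (rev (e # w)) = wval G \<iota>' (rev w) \<otimes>\<^bsub>G\<^esub> \<iota>' e"
      using Cons app[of "rev w" "[e]"] c by (simp add: wval_def)
    ultimately have "wval G \<iota>' (e # w) \<otimes>\<^bsub>G\<^esub> wval G \<iota>' (rev (e # w))
       = \<iota>' e \<otimes>\<^bsub>G\<^esub> (wval G \<iota>' w \<otimes>\<^bsub>G\<^esub> wval G \<iota>' (rev w)) \<otimes>\<^bsub>G\<^esub> \<iota>' e"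
      using c by (simp add: G.m_assoc)
    then show ?case using Cons c assms(4) by simp
  qed (simp add: wval_def)
  have wd: "wval G \<iota>' u = wval G \<iota>' v"
    if "set u \<subseteq> E" "set v \<subseteq> E" "wval H \<kappa> u = wval H \<kappa> v" for u v
  proof -
    have "wval H \<kappa> (u @ rev v) = \<one>\<^bsub>H\<^esub>" using that H.val_eq_iff by blast
    then have "wval G \<iota>' u \<otimes>\<^bsub>G\<^esub> wval G \<iota>' (rev v) = \<one>\<^bsub>G\<^esub>"
      using ker[of "u @ rev v"] that app[of u "rev v"] by simp
    moreover have "wval G \<iota>' v \<otimes>\<^bsub>G\<^esub> wval G \<iota>' (rev v) = \<one>\<^bsub>G\<^esub>" using rev1 that by simp
    ultimately show ?thesis using cl that by (metis G.right_cancel set_rev)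
  qed
  define h where "h x = wval G \<iota>' (SOME w. set w \<subseteq> E \<and> wval H \<kappa> w = x)" for x
  have h: "h (wval H \<kappa> w) = wval G \<iota>' w" if "set w \<subseteq> E" for w
  proof -
    have "set (SOME u. set u \<subseteq> E \<and> wval H \<kappa> u = wval H \<kappa> w) \<subseteq> E \<and>
      wval H \<kappa> (SOME u. set u \<subseteq> E \<and> wval H \<kappa> u = wval H \<kappa> w) = wval H \<kappa> w"
      by (rule someI[of _ w]) (use that in simp)
    then show ?thesis unfolding h_def using wd that by blast
  qed
  have "h \<in> hom H G"
  proof (rule homI)
    fix x assume "x \<in> carrier H"
    then obtain w where "set w \<subseteq> E" "x = wval H \<kappa> w" using H.carrier_val by auto
    then show "h x \<in> carrier G" using h cl by simp
  next
    fix x y assume "x \<in> carrier H" "y \<in> carrier H"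
    then obtain u v where uv: "set u \<subseteq> E" "x = wval H \<kappa> u" "set v \<subseteq> E" "y = wval H \<kappa> v"
      using H.carrier_val by auto
    then have "x \<otimes>\<^bsub>H\<^esub> y = wval H \<kappa> (u @ v)" by simp
    then show "h (x \<otimes>\<^bsub>H\<^esub> y) = h x \<otimes>\<^bsub>G\<^esub> h y" using uv h[of "u @ v"] h app by auto
  qed
  with h show thesis using that by blast
qed

text \<open>The group of permutations of \<open>\<Omega>\<close> induced by words, with its elements
  numbered. The fixed carrier type \<open>nat\<close> is what permits an induction over expansions,
  whose elements would otherwise change type at every step.\<close>

lemma group_of_action:
  fixes p :: "'e \<Rightarrow> 'x \<Rightarrow> 'x"
  assumes fin: "finite \<Omega>" and act: "acts E \<Omega> p"
    and inj: "\<And>e f. e \<in> E \<Longrightarrow> f \<in> E \<Longrightarrow> e \<noteq> f \<Longrightarrow> \<exists>v\<in>\<Omega>. p e v \<noteq> p f v"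
    and nontriv: "\<And>e. e \<in> E \<Longrightarrow> \<exists>v\<in>\<Omega>. p e v \<noteq> v"
  obtains H :: "nat monoid" and \<kappa> where "E_group E H \<kappa>" "finite (carrier H)"
    "\<And>w. set w \<subseteq> E \<Longrightarrow> wval H \<kappa> w = \<one>\<^bsub>H\<^esub> \<longleftrightarrow> (\<forall>v\<in>\<Omega>. fold p w v = v)"
proof -
  define f where "f w = restrict (fold p w) \<Omega>" for w
  define C where "C = f ` {w. set w \<subseteq> E}"
  have "C \<subseteq> \<Omega> \<rightarrow>\<^sub>E \<Omega>" using acts_fold[OF act] by (auto simp: C_def f_def)
  then have finC: "finite C" using fin finite_PiE[of \<Omega> "\<lambda>_. \<Omega>"] finite_subset by blast
  then obtain b where b: "bij_betw b C {0..<card C}" using ex_bij_betw_finite_nat by blast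
  define c where "c w = b (f w)" for w
  have c_eq: "c u = c v \<longleftrightarrow> (\<forall>x\<in>\<Omega>. fold p u x = fold p v x)" if "set u \<subseteq> E" "set v \<subseteq> E" for u v
  proof -
    have "f u \<in> C" "f v \<in> C" using that by (auto simp: C_def)
    then have "c u = c v \<longleftrightarrow> f u = f v" unfolding c_def using b by (auto simp: bij_betw_def inj_on_eq_iff)
    also have "\<dots> \<longleftrightarrow> (\<forall>x\<in>\<Omega>. fold p u x = fold p v x)"
      by (auto simp: f_def restrict_def fun_eq_iff)
    finally show ?thesis .
  qed
  \<comment> \<open>Products are computed by concatenating words, so each number needs a chosen
    word; \<open>mult\<close> shows that the choice does not matter.\<close>
  define r where "r x = (SOME w. set w \<subseteq> E \<and> c w = x)" for x
  have r: "set (r (c w)) \<subseteq> E \<and> c (r (c w)) = c w" if "set w \<subseteq> E" for w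
    unfolding r_def by (rule someI[of _ w]) (use that in simp)
  define H :: "nat monoid" where
    "H = \<lparr>carrier = c ` {w. set w \<subseteq> E}, monoid.mult = (\<lambda>x y. c (r x @ r y)), one = c []\<rparr>"
  define \<kappa> where "\<kappa> e = c [e]" for e
  have mult: "c u \<otimes>\<^bsub>H\<^esub> c v = c (u @ v)" if "set u \<subseteq> E" "set v \<subseteq> E" for u v
  proof -
    have "fold p (r (c u)) x = fold p u x" "fold p (r (c v)) x = fold p v x" if "x \<in> \<Omega>" for x
      using r[OF \<open>set u \<subseteq> E\<close>] r[OF \<open>set v \<subseteq> E\<close>] c_eq \<open>set u \<subseteq> E\<close> \<open>set v \<subseteq> E\<close> that by blast+
    then have "\<forall>x\<in>\<Omega>. fold p (r (c u) @ r (c v)) x = fold p (u @ v) x"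
      using acts_fold[OF act] that by simp
    then show ?thesis using r that c_eq[of "r (c u) @ r (c v)" "u @ v"] by (auto simp: H_def)
  qed
  have one: "\<one>\<^bsub>H\<^esub> = c []" by (simp add: H_def)
  have carr: "carrier H = c ` {w. set w \<subseteq> E}" by (simp add: H_def)
  have grp: "group H"
  proof (rule groupI)
    fix x assume "x \<in> carrier H"
    then obtain u where u: "set u \<subseteq> E" "x = c u" by (auto simp: carr)
    have "c (rev u @ u) = c []" using c_eq[of "rev u @ u" "[]"] u acts_fold_rev'[OF act] by simp
    then show "\<exists>y\<in>carrier H. y \<otimes>\<^bsub>H\<^esub> x = \<one>\<^bsub>H\<^esub>"
      using u mult[of "rev u" u] by (auto simp: carr one intro!: exI[of _ "rev u"])
  next
    fix x y z assume "x \<in> carrier H" "y \<in> carrier H" "z \<in> carrier H"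
    then show "x \<otimes>\<^bsub>H\<^esub> y \<otimes>\<^bsub>H\<^esub> z = x \<otimes>\<^bsub>H\<^esub> (y \<otimes>\<^bsub>H\<^esub> z)"
      by (auto simp: carr mult)
  qed (auto simp: carr one mult)
  interpret H: group H by (rule grp)
  have val: "wval H \<kappa> w = c w" if "set w \<subseteq> E" for w
    using that by (induction w) (auto simp: wval_def one \<kappa>_def mult)
  have ker: "wval H \<kappa> w = \<one>\<^bsub>H\<^esub> \<longleftrightarrow> (\<forall>v\<in>\<Omega>. fold p w v = v)" if "set w \<subseteq> E" for w
    using that c_eq[of w "[]"] by (simp add: val one)
  have sub: "\<kappa> ` E \<subseteq> carrier H" by (auto simp: \<kappa>_def carr)
  have gen: "c w \<in> generate H (\<kappa> ` E)" if "set w \<subseteq> E" for w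
    using that
  proof (induction w)
    case Nil
    show ?case using generate.one[of H] by (simp add: one)
  next
    case (Cons e w)
    then have "c (e # w) = \<kappa> e \<otimes>\<^bsub>H\<^esub> c w" using mult[of "[e]" w] by (simp add: \<kappa>_def)
    moreover have "\<kappa> e \<in> generate H (\<kappa> ` E)" using Cons by (auto intro: generate.incl)
    ultimately show ?case using Cons by (auto intro: generate.eng)
  qed
  have "E_group E H \<kappa>"
    unfolding E_group_def
  proof (intro conjI ballI)
    show "inj_on \<kappa> E"
      using inj c_eq by (fastforce simp: inj_on_def \<kappa>_def)
    fix e assume e: "e \<in> E"
    show "\<kappa> e \<noteq> \<one>\<^bsub>H\<^esub>" using e nontriv c_eq[of "[e]" "[]"] by (auto simp: \<kappa>_def one)
    show "\<kappa> e \<otimes>\<^bsub>H\<^esub> \<kappa> e = \<one>\<^bsub>H\<^esub>"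
      using e c_eq[of "[e, e]" "[]"] act by (auto simp: \<kappa>_def one mult acts_def)
  next
    show "generate H (\<kappa> ` E) = carrier H"
      using gen H.generate_in_carrier[OF sub] by (auto simp: carr)
  qed (use grp sub in auto)
  moreover have "finite (carrier H)" using finC by (auto simp: carr c_def C_def image_image[symmetric])
  ultimately show thesis using ker that by blast
qed

section \<open>Expansions that preserve words over few letters\<close>

text \<open>For a permutation of \<open>E\<close> this is equivalent to
  \<open>group_symmetry\<close>, as shown at the end. Speaking of trivial words instead of
  automorphisms, it can be carried through expansions.\<close>

definition symmetric_kernel :: "'e set \<Rightarrow> ('g, 'b) monoid_scheme \<Rightarrow> ('e \<Rightarrow> 'g) \<Rightarrow> ('e \<Rightarrow> 'e) \<Rightarrow> bool" where
  "symmetric_kernel E G \<iota> \<rho> \<longleftrightarrow>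
    (\<forall>w. set w \<subseteq> E \<longrightarrow> (wval G \<iota> w = \<one>\<^bsub>G\<^esub> \<longleftrightarrow> wval G \<iota> (map \<rho> w) = \<one>\<^bsub>G\<^esub>))"

text \<open>The bound concerns the number of distinct letters; the length of the word is
  arbitrary.\<close>

definition locally_compatible ::
  "'e set \<Rightarrow> nat \<Rightarrow> ('g, 'b) monoid_scheme \<Rightarrow> ('e \<Rightarrow> 'g) \<Rightarrow> 'x set \<Rightarrow> ('e \<Rightarrow> 'x \<Rightarrow> 'x) \<Rightarrow> bool" where
  "locally_compatible E k G \<iota> V p \<longleftrightarrow>
    (\<forall>w. set w \<subseteq> E \<and> card (set w) \<le> k \<and> wval G \<iota> w = \<one>\<^bsub>G\<^esub> \<longrightarrow> (\<forall>v\<in>V. fold p w v = v))"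

definition globally_compatible ::
  "'e set \<Rightarrow> ('g, 'b) monoid_scheme \<Rightarrow> ('e \<Rightarrow> 'g) \<Rightarrow> 'x set \<Rightarrow> ('e \<Rightarrow> 'x \<Rightarrow> 'x) \<Rightarrow> bool" where
  "globally_compatible E G \<iota> V p \<longleftrightarrow>
    (\<forall>w. set w \<subseteq> E \<and> wval G \<iota> w = \<one>\<^bsub>G\<^esub> \<longrightarrow> (\<forall>v\<in>V. fold p w v = v))"

lemma symmetric_kernel_inv:
  assumes "\<rho> permutes E" "symmetric_kernel E G \<iota> \<rho>"
  shows "symmetric_kernel E G \<iota> (inv_into UNIV \<rho>)"
  unfolding symmetric_kernel_def
proof (intro allI impI)
  fix w assume w: "set w \<subseteq> E"
  have "set (map (inv_into UNIV \<rho>) w) \<subseteq> E"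
    using w permutes_in_image[OF permutes_inv[OF assms(1)]] by auto
  moreover have "map \<rho> (map (inv_into UNIV \<rho>) w) = w"
    using permutes_inverses(1)[OF assms(1)] by (simp add: map_idI)
  ultimately show "(wval G \<iota> w = \<one>\<^bsub>G\<^esub>) = (wval G \<iota> (map (inv_into UNIV \<rho>) w) = \<one>\<^bsub>G\<^esub>)"
    using assms(2) unfolding symmetric_kernel_def by metis
qed

text \<open>\<open>H\<close> is generated by \<open>G\<close> together with \<^emph>\<open>all\<close> sufficiently small actions compatible with the
  words over at most \<open>k\<close> letters, not just by those needed later: this makes it canonical, hence
  symmetric.\<close>

lemma expansion:
  fixes E :: "'e set" and G :: "('g, 'b) monoid_scheme"
  assumes eg: "E_group E G \<iota>" and finE: "finite E" and finG: "finite (carrier G)"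
  obtains H :: "nat monoid" and \<kappa> where "E_group E H \<kappa>" "finite (carrier H)"
    "\<And>w. set w \<subseteq> E \<Longrightarrow> wval H \<kappa> w = \<one>\<^bsub>H\<^esub> \<Longrightarrow> wval G \<iota> w = \<one>\<^bsub>G\<^esub>"
    "\<And>w. set w \<subseteq> E \<Longrightarrow> card (set w) \<le> k \<Longrightarrow> wval G \<iota> w = \<one>\<^bsub>G\<^esub> \<Longrightarrow> wval H \<kappa> w = \<one>\<^bsub>H\<^esub>"
    "\<And>p :: 'e \<Rightarrow> nat \<Rightarrow> nat. acts E {..<M} p \<Longrightarrow> locally_compatible E k G \<iota> {..<M} p \<Longrightarrow>
       globally_compatible E H \<kappa> {..<M} p"
    "\<And>\<rho>. \<rho> permutes E \<Longrightarrow> symmetric_kernel E G \<iota> \<rho> \<Longrightarrow> symmetric_kernel E H \<kappa> \<rho>"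
proof -
  interpret egrp E G \<iota> by unfold_locales fact
  \<comment> \<open>The default value \<open>0\<close> leaves one function for each action on
    \<open>{..<M}\<close>; this makes \<open>\<P>\<close> finite.\<close>
  define \<P> where "\<P> = {p :: 'e \<Rightarrow> nat \<Rightarrow> nat. acts E {..<M} p \<and> locally_compatible E k G \<iota> {..<M} p
      \<and> (\<forall>e n. e \<notin> E \<or> n \<ge> M \<longrightarrow> p e n = 0)}"
  have "finite \<P>"
  proof -
    have "finite {f :: 'e \<times> nat \<Rightarrow> nat. \<forall>x. (x \<in> E \<times> {..<M} \<longrightarrow> f x \<in> {..<M}) \<and> (x \<notin> E \<times> {..<M} \<longrightarrow> f x = 0)}"
      by (intro finite_set_of_finite_funs) (use finE in auto)
    moreover have "(\<lambda>p (e, n). p e n) ` \<P> \<subseteq> {f :: 'e \<times> nat \<Rightarrow> nat. \<forall>x. (x \<in> E \<times> {..<M} \<longrightarrow> f x \<in> {..<M}) \<and> (x \<notin> E \<times> {..<M} \<longrightarrow> f x = 0)}"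
      by (auto simp: \<P>_def acts_def)
    moreover have "inj_on (\<lambda>p (e, n). p e n) \<P>"
      by (auto simp: inj_on_def fun_eq_iff)
    ultimately show ?thesis using finite_imageD finite_subset by blast
  qed
  \<comment> \<open>The regular action of \<open>G\<close> is a summand: it yields the map from
    \<open>H\<close> to \<open>G\<close> and keeps the letters distinct and nontrivial.\<close>
  define \<Omega> where "\<Omega> = Inl ` carrier G \<union> Inr ` (\<P> \<times> {..<M})"
  define act where "act e x = (case x of Inl g \<Rightarrow> Inl (g \<otimes>\<^bsub>G\<^esub> \<iota> e) | Inr (p, n) \<Rightarrow> Inr (p, p e n))"
    for e and x :: "'g + ('e \<Rightarrow> nat \<Rightarrow> nat) \<times> nat"
  have fin: "finite \<Omega>" using finG \<open>finite \<P>\<close> by (auto simp: \<Omega>_def)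
  have acts: "acts E \<Omega> act"
    using acts_right_mult by (auto simp: acts_def \<Omega>_def act_def \<P>_def)
  have foldL: "fold act w (Inl x) = Inl (x \<otimes>\<^bsub>G\<^esub> val w)" if "set w \<subseteq> E" "x \<in> carrier G" for w x
  proof -
    have "fold act w (Inl x) = Inl (fold (\<lambda>e x. x \<otimes>\<^bsub>G\<^esub> \<iota> e) w x)"
      by (rule fold_conjugate[where V="carrier G"]) (use that gen_closed in \<open>auto simp: act_def\<close>)
    then show ?thesis using that by (simp add: fold_right_mult)
  qed
  have foldR: "fold act w (Inr (p, n)) = Inr (p, fold p w n)" for w p n
    by (induction w arbitrary: n) (auto simp: act_def)
  have triv: "(\<forall>v\<in>\<Omega>. fold act w v = v) \<longleftrightarrow>
     val w = \<one>\<^bsub>G\<^esub> \<and> (\<forall>p\<in>\<P>. \<forall>n<M. fold p w n = n)" if w: "set w \<subseteq> E" for w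
  proof -
    have "(\<forall>v\<in>\<Omega>. fold act w v = v) \<longleftrightarrow> (\<forall>x\<in>carrier G. fold act w (Inl x) = Inl x) \<and>
      (\<forall>p\<in>\<P>. \<forall>n<M. fold act w (Inr (p, n)) = Inr (p, n))"
      unfolding \<Omega>_def by blast
    also have "\<dots> \<longleftrightarrow>
      (\<forall>x\<in>carrier G. x \<otimes>\<^bsub>G\<^esub> val w = x) \<and> (\<forall>p\<in>\<P>. \<forall>n<M. fold p w n = n)"
      using foldL[OF w] by (simp add: foldR)
    also have "(\<forall>x\<in>carrier G. x \<otimes>\<^bsub>G\<^esub> val w = x) \<longleftrightarrow> val w = \<one>\<^bsub>G\<^esub>"
      using w by (auto simp: mult_eq_self)
    finally show ?thesis .
  qed
  have one_in: "Inl \<one>\<^bsub>G\<^esub> \<in> \<Omega>" by (auto simp: \<Omega>_def)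
  obtain H :: "nat monoid" and \<kappa> where H: "E_group E H \<kappa>" "finite (carrier H)"
    and ker: "\<And>w. set w \<subseteq> E \<Longrightarrow> wval H \<kappa> w = \<one>\<^bsub>H\<^esub> \<longleftrightarrow> (\<forall>v\<in>\<Omega>. fold act w v = v)"
  proof (rule group_of_action[OF fin acts])
    show "\<exists>v\<in>\<Omega>. act e v \<noteq> act f v" if "e \<in> E" "f \<in> E" "e \<noteq> f" for e f
      using that eg one_in
      by (intro bexI[of _ "Inl \<one>\<^bsub>G\<^esub>"]) (auto simp: act_def gen_closed E_group_def inj_on_def)
    show "\<exists>v\<in>\<Omega>. act e v \<noteq> v" if "e \<in> E" for e
      using that eg one_in
      by (intro bexI[of _ "Inl \<one>\<^bsub>G\<^esub>"]) (auto simp: act_def gen_closed E_group_def)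
  qed blast
  show thesis
  proof (rule that[OF H])
    fix w assume w: "set w \<subseteq> E" and 1: "wval H \<kappa> w = \<one>\<^bsub>H\<^esub>"
    then show "val w = \<one>\<^bsub>G\<^esub>" using ker triv by simp
  next
    fix w assume "set w \<subseteq> E" "card (set w) \<le> k" "val w = \<one>\<^bsub>G\<^esub>"
    then show "wval H \<kappa> w = \<one>\<^bsub>H\<^esub>"
      using ker triv by (auto simp: \<P>_def locally_compatible_def)
  next
    fix p :: "'e \<Rightarrow> nat \<Rightarrow> nat" assume p: "acts E {..<M} p" "locally_compatible E k G \<iota> {..<M} p"
    define q where "q e n = (if e \<in> E \<and> n < M then p e n else 0)" for e n
    have fold_q: "fold p w n = fold q w n" if "set w \<subseteq> E" "n < M" for w n
      by (rule fold_agree[where V="{..<M}"]) (use that p(1) in \<open>auto simp: q_def acts_def\<close>)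
    have "acts E {..<M} q" using p(1) by (auto simp: acts_def q_def)
    moreover have "locally_compatible E k G \<iota> {..<M} q"
      using p(2) fold_q by (auto simp: locally_compatible_def)
    ultimately have "q \<in> \<P>" by (auto simp: \<P>_def q_def)
    then show "globally_compatible E H \<kappa> {..<M} p"
      using ker triv fold_q by (auto simp: globally_compatible_def)
  next
    have *: "wval H \<kappa> (map \<rho> w) = \<one>\<^bsub>H\<^esub>"
      if \<rho>: "\<rho> permutes E" and s: "symmetric_kernel E G \<iota> \<rho>" and w: "set w \<subseteq> E"
        and 1: "wval H \<kappa> w = \<one>\<^bsub>H\<^esub>" for \<rho> w
    proof -
      have w': "set (map \<rho> w) \<subseteq> E" using w permutes_in_image[OF \<rho>] by auto
      have "fold p (map \<rho> w) n = n" if "p \<in> \<P>" "n < M" for p n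
      proof -
        \<comment> \<open>\<open>\<P>\<close> is closed under relabelling by \<open>\<rho>\<close>,
          since this does not increase the number of letters of a word and, by \<open>s\<close>,
          preserves its triviality in \<open>G\<close>.\<close>
        have "(\<lambda>e. p (\<rho> e)) \<in> \<P>"
          unfolding \<P>_def
        proof (intro CollectI conjI)
          show "acts E {..<M} (\<lambda>e. p (\<rho> e))"
            using \<open>p \<in> \<P>\<close> permutes_in_image[OF \<rho>] by (auto simp: \<P>_def acts_def)
          show "\<forall>e n. e \<notin> E \<or> M \<le> n \<longrightarrow> p (\<rho> e) n = 0"
            using \<open>p \<in> \<P>\<close> permutes_in_image[OF \<rho>] by (auto simp: \<P>_def)
          show "locally_compatible E k G \<iota> {..<M} (\<lambda>e. p (\<rho> e))"
            unfolding locally_compatible_def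
          proof (intro allI impI, elim conjE)
            fix u assume u: "set u \<subseteq> E" "card (set u) \<le> k" "val u = \<one>\<^bsub>G\<^esub>"
            have "card (set (map \<rho> u)) \<le> k" using u(2) card_image_le[of "set u" \<rho>] by simp
            moreover have "set (map \<rho> u) \<subseteq> E" using u permutes_in_image[OF \<rho>] by auto
            moreover have "val (map \<rho> u) = \<one>\<^bsub>G\<^esub>" using s u by (auto simp: symmetric_kernel_def)
            ultimately have "\<forall>v\<in>{..<M}. fold p (map \<rho> u) v = v"
              using \<open>p \<in> \<P>\<close> unfolding \<P>_def locally_compatible_def by blast
            then show "\<forall>v\<in>{..<M}. fold (\<lambda>e. p (\<rho> e)) u v = v" by (simp only: fold_map_letters)
          qed
        qed
        then show ?thesis using 1 ker[OF w] triv[OF w] \<open>n < M\<close> by (simp only: fold_map_letters)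
      qed
      moreover have "val (map \<rho> w) = \<one>\<^bsub>G\<^esub>"
        using 1 ker[OF w] triv[OF w] s w by (auto simp: symmetric_kernel_def)
      ultimately show ?thesis using ker[OF w'] triv[OF w'] by simp
    qed
    fix \<rho> assume \<rho>: "\<rho> permutes E" and s: "symmetric_kernel E G \<iota> \<rho>"
    show "symmetric_kernel E H \<kappa> \<rho>"
      unfolding symmetric_kernel_def
    proof (intro allI impI iffI)
      fix w assume w: "set w \<subseteq> E" and 1: "wval H \<kappa> (map \<rho> w) = \<one>\<^bsub>H\<^esub>"
      have "set (map \<rho> w) \<subseteq> E" using w permutes_in_image[OF \<rho>] by auto
      then have "wval H \<kappa> (map (inv_into UNIV \<rho>) (map \<rho> w)) = \<one>\<^bsub>H\<^esub>"
        using * permutes_inv[OF \<rho>] symmetric_kernel_inv[OF \<rho> s] 1 by blast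
      then show "wval H \<kappa> w = \<one>\<^bsub>H\<^esub>"
        using permutes_inverses(2)[OF \<rho>] by (simp add: map_idI)
    qed (use * \<rho> s in blast)
  qed
qed

text \<open>The expansion knows only actions on \<open>{..<M}\<close>; an action on at most
  \<open>M\<close> points is copied there, with the remaining numbers fixed by all letters.\<close>

lemma compatible_of_small:
  fixes V :: "'x set" and p :: "'e \<Rightarrow> 'x \<Rightarrow> 'x"
  assumes small: "\<And>p :: 'e \<Rightarrow> nat \<Rightarrow> nat. acts E {..<M} p \<Longrightarrow> locally_compatible E k G \<iota> {..<M} p \<Longrightarrow>
       globally_compatible E H \<kappa> {..<M} p"
    and V: "finite V" "card V \<le> M" and p: "acts E V p" "locally_compatible E k G \<iota> V p"
  shows "globally_compatible E H \<kappa> V p"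
proof -
  obtain h where h: "inj_on h V" "h ` V \<subseteq> {..<M}"
    using V by (metis card_le_inj card_lessThan finite_lessThan)
  define q where "q e n = (if n \<in> h ` V then h (p e (inv_into V h n)) else n)" for e n
  have qh: "q e (h v) = h (p e v)" if "v \<in> V" for e v
    using that h(1) by (simp add: q_def)
  have fold_q: "fold q w (h v) = h (fold p w v)" if "set w \<subseteq> E" "v \<in> V" for w v
    by (rule fold_conjugate[where V=V]) (use that p(1) qh in \<open>auto simp: acts_def\<close>)
  have fold_out: "fold q w n = n" if "n \<notin> h ` V" for w n
    using that by (induction w) (auto simp: q_def)
  have "acts E {..<M} q"
    unfolding acts_def
  proof (intro ballI)
    fix e n assume e: "e \<in> E" "n \<in> {..<M}"
    show "q e n \<in> {..<M} \<and> q e (q e n) = n"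
    proof (cases "n \<in> h ` V")
      case True
      then obtain v where "v \<in> V" "n = h v" by auto
      moreover from this e p(1) have "p e v \<in> V" "p e (p e v) = v" by (auto simp: acts_def)
      ultimately show ?thesis using qh h(2) by auto
    next
      case False
      then show ?thesis using e by (simp add: q_def)
    qed
  qed
  moreover have "locally_compatible E k G \<iota> {..<M} q"
    unfolding locally_compatible_def
  proof (intro allI impI ballI, elim conjE)
    fix w n assume w: "set w \<subseteq> E" "card (set w) \<le> k" "wval G \<iota> w = \<one>\<^bsub>G\<^esub>"
    show "fold q w n = n"
      using p(2) w fold_q fold_out[of n w] unfolding locally_compatible_def by (cases "n \<in> h ` V") auto
  qed
  ultimately have g: "globally_compatible E H \<kappa> {..<M} q" using small by blast
  show ?thesis
    unfolding globally_compatible_def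
  proof (intro allI impI ballI, elim conjE)
    fix w v assume w: "set w \<subseteq> E" "wval H \<kappa> w = \<one>\<^bsub>H\<^esub>" and v: "v \<in> V"
    have "h (fold p w v) = h v"
      using g w v h(2) fold_q[OF w(1) v] unfolding globally_compatible_def by fastforce
    then show "fold p w v = v" using h(1) acts_fold[OF p(1) w(1) v] v by (auto simp: inj_on_def)
  qed
qed

section \<open>Chains of free orbits\<close>

text \<open>By \<open>free\<close> and \<open>orbit\<close> every nonempty layer \<open>V i\<close>
  is a copy of \<open>G[\<beta> i]\<close>, and by \<open>far\<close> and \<open>overlap\<close>
  only consecutive layers meet, in at most one orbit of the common letters. Axioms are preferred to
  a construction because the components of a chain under fewer letters have to be chains again;
  empty layers are allowed for the same reason.\<close>

locale chain = egrp E G \<iota>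
  for E :: "'e set" and G :: "('g, 'b) monoid_scheme" (structure) and \<iota> :: "'e \<Rightarrow> 'g" +
  fixes n :: nat and V :: "nat \<Rightarrow> 'x set" and \<beta> :: "nat \<Rightarrow> 'e set" and p :: "'e \<Rightarrow> 'x \<Rightarrow> 'x"
  assumes letters: "i < n \<Longrightarrow> \<beta> i \<subseteq> E"
    and layer_acts: "i < n \<Longrightarrow> acts (\<beta> i) (V i) p"
    and fixed: "i < n \<Longrightarrow> v \<in> V i \<Longrightarrow> e \<in> E \<Longrightarrow> (\<And>j. j < n \<Longrightarrow> v \<in> V j \<Longrightarrow> e \<notin> \<beta> j) \<Longrightarrow> p e v = v"
    and free: "i < n \<Longrightarrow> v \<in> V i \<Longrightarrow> set w \<subseteq> \<beta> i \<Longrightarrow> fold p w v = v \<longleftrightarrow> wval G \<iota> w = \<one>"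
    and orbit: "i < n \<Longrightarrow> u \<in> V i \<Longrightarrow> v \<in> V i \<Longrightarrow> \<exists>w. set w \<subseteq> \<beta> i \<and> fold p w u = v"
    and far: "i + 2 \<le> j \<Longrightarrow> j < n \<Longrightarrow> V i \<inter> V j = {}"
    and overlap: "Suc i < n \<Longrightarrow> u \<in> V i \<inter> V (Suc i) \<Longrightarrow> v \<in> V i \<inter> V (Suc i) \<Longrightarrow>
       \<exists>w. set w \<subseteq> \<beta> i \<inter> \<beta> (Suc i) \<and> fold p w u = v"
begin

lemma stay: "i < n \<Longrightarrow> v \<in> V i \<Longrightarrow> set w \<subseteq> \<beta> i \<Longrightarrow> fold p w v \<in> V i"
  using acts_fold[OF layer_acts] by blast

lemma acts_all: "acts E (\<Union>i<n. V i) p"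
  unfolding acts_def
proof (intro ballI)
  fix e v assume e: "e \<in> E" and "v \<in> (\<Union>i<n. V i)"
  then obtain i where i: "i < n" "v \<in> V i" by auto
  show "p e v \<in> (\<Union>i<n. V i) \<and> p e (p e v) = v"
  proof (cases "\<exists>j<n. v \<in> V j \<and> e \<in> \<beta> j")
    case True
    then obtain j where "j < n" "v \<in> V j" "e \<in> \<beta> j" by auto
    then show ?thesis using layer_acts[of j] by (auto simp: acts_def)
  next
    case False
    then have "p e v = v" using fixed[OF i e] by blast
    then show ?thesis using i by auto
  qed
qed

text \<open>From a fixed point of the layer, a word leads to a point that depends only on the value
  of the word.\<close>

lemma card_layer:
  assumes fin: "finite (carrier G)" and i: "i < n"
  shows "finite (V i) \<and> card (V i) \<le> card (carrier G)"
proof (cases "V i = {}")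
  case False
  then obtain u where u: "u \<in> V i" by auto
  define h where "h x = fold p (SOME w. set w \<subseteq> \<beta> i \<and> val w = x) u" for x
  have "V i \<subseteq> h ` carrier G"
  proof
    fix v assume "v \<in> V i"
    then obtain w where w: "set w \<subseteq> \<beta> i" "fold p w u = v" using orbit[OF i u] by blast
    define w' where "w' = (SOME w'. set w' \<subseteq> \<beta> i \<and> val w' = val w)"
    have w': "set w' \<subseteq> \<beta> i \<and> val w' = val w"
      unfolding w'_def by (rule someI[of _ w]) (use w in simp)
    then have "val (w @ rev w') = \<one>" using w letters[OF i] val_eq_iff[of w w'] by auto
    then have "fold p (w @ rev w') u = u" using free[OF i u, of "w @ rev w'"] w w' by auto
    then have "fold p (rev w') v = u" using w by simp
    then have "fold p w' u = v"
      using acts_fold_rev'[OF layer_acts[OF i]] \<open>v \<in> V i\<close> w' by metis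
    then have "h (val w) = v" unfolding h_def w'_def by simp
    moreover have "val w \<in> carrier G" using w letters[OF i] by auto
    ultimately show "v \<in> h ` carrier G" by blast
  qed
  then show ?thesis using fin by (meson card_image_le card_mono finite_imageI finite_subset le_trans)
qed simp

lemma card_all:
  assumes fin: "finite (carrier G)"
  shows "finite (\<Union>i<n. V i) \<and> card (\<Union>i<n. V i) \<le> n * card (carrier G)"
proof
  show "finite (\<Union>i<n. V i)" using card_layer[OF fin] by auto
  have "card (\<Union>i<n. V i) \<le> (\<Sum>i<n. card (V i))" by (rule card_UN_le) simp
  also have "\<dots> \<le> (\<Sum>i<n. card (carrier G))" by (rule sum_mono) (use card_layer[OF fin] in auto)
  finally show "card (\<Union>i<n. V i) \<le> n * card (carrier G)" by simp
qed

end

text \<open>This climbs one layer at a time and never comes back. That it nevertheless reaches the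
  whole component is shown inside \<open>component_orbit\<close>; the reason is that each stage is a
  single orbit of the letters in \<open>A\<close> of its layer.\<close>

primrec spread ::
  "('e \<Rightarrow> 'x \<Rightarrow> 'x) \<Rightarrow> 'e set \<Rightarrow> (nat \<Rightarrow> 'e set) \<Rightarrow> (nat \<Rightarrow> 'x set) \<Rightarrow> 'x \<Rightarrow> nat \<Rightarrow> nat \<Rightarrow> 'x set" where
  "spread p A \<beta> V u l 0 = {fold p q u | q. set q \<subseteq> \<beta> l \<inter> A}"
| "spread p A \<beta> V u l (Suc m) =
    {fold p q x | q x. x \<in> spread p A \<beta> V u l m \<inter> V (l + Suc m) \<and> set q \<subseteq> \<beta> (l + Suc m) \<inter> A}"

lemma spread_closed:
  assumes "x \<in> spread p A \<beta> V u l m" "set q \<subseteq> \<beta> (l + m) \<inter> A"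
  shows "fold p q x \<in> spread p A \<beta> V u l m"
proof (cases m)
  case 0
  with assms obtain r where "x = fold p r u" "set r \<subseteq> \<beta> l \<inter> A" by auto
  then show ?thesis using assms 0 by (auto intro!: exI[of _ "r @ q"])
next
  case (Suc m')
  with assms obtain r y where "x = fold p r y" "y \<in> spread p A \<beta> V u l m' \<inter> V (l + Suc m')"
    "set r \<subseteq> \<beta> (l + Suc m') \<inter> A" by auto
  then show ?thesis using assms Suc by (auto intro!: exI[of _ "r @ q"] exI[of _ y])
qed

text \<open>Erasing the letters outside \<open>A\<close> is then a well-defined retraction of
  \<open>G\<close> onto \<open>G[A]\<close>. If \<open>q\<close> over \<open>A\<close> and
  \<open>z\<close> over \<open>B\<close> have the same value, erasure in \<open>q @ rev z\<close>
  shows that this is also the value of a word over \<open>A \<inter> B\<close>.\<close>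

definition retractable :: "'e set \<Rightarrow> nat \<Rightarrow> ('g, 'b) monoid_scheme \<Rightarrow> ('e \<Rightarrow> 'g) \<Rightarrow> bool" where
  "retractable E k G \<iota> \<longleftrightarrow> (\<forall>A w. A \<subseteq> E \<and> card A < k \<and> set w \<subseteq> E \<and> wval G \<iota> w = \<one>\<^bsub>G\<^esub> \<longrightarrow>
     wval G \<iota> (filter (\<lambda>e. e \<in> A) w) = \<one>\<^bsub>G\<^esub>)"

context chain
begin

text \<open>The component of a vertex under a letter set contained in none of the \<open>\<beta> i\<close> it meets is again
  a chain, with the letter sets cut down. The point is that every layer is met in a single orbit;
  this is seen by spreading upwards from the lowest layer of the component.\<close>

context
  fixes A :: "'e set" and k :: nat and v :: 'x and C :: "'x set"
  assumes finA: "finite A" and AE: "A \<subseteq> E" and cardA: "card A \<le> k" and retr: "retractable E k G \<iota>"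
    and v: "v \<in> (\<Union>i<n. V i)"
    and unsat: "\<And>j. j < n \<Longrightarrow> v \<in> V j \<Longrightarrow> \<not> A \<subseteq> \<beta> j"
  defines "C \<equiv> {fold p u v | u. set u \<subseteq> A}"
begin

lemma acts_A: "acts A (\<Union>i<n. V i) p"
  by (rule acts_mono[OF acts_all AE])

lemma C_closed: "x \<in> C \<Longrightarrow> set u \<subseteq> A \<Longrightarrow> fold p u x \<in> C"
proof -
  assume "x \<in> C" "set u \<subseteq> A"
  then obtain r where "x = fold p r v" "set r \<subseteq> A" by (auto simp: C_def)
  then show ?thesis using \<open>set u \<subseteq> A\<close> by (auto simp: C_def intro!: exI[of _ "r @ u"])
qed

lemma C_back: "x \<in> C \<Longrightarrow> \<exists>u. set u \<subseteq> A \<and> fold p u x = v"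
proof -
  assume "x \<in> C"
  then obtain r where "x = fold p r v" "set r \<subseteq> A" by (auto simp: C_def)
  then show ?thesis using acts_fold_rev[OF acts_A _ v, of r] by (intro exI[of _ "rev r"]) auto
qed

lemma C_connected:
  assumes "x \<in> C" "y \<in> C"
  shows "\<exists>u. set u \<subseteq> A \<and> fold p u x = y"
proof -
  obtain r where r: "set r \<subseteq> A" "fold p r x = v" using C_back assms by blast
  obtain s where s: "set s \<subseteq> A" "y = fold p s v" using assms by (auto simp: C_def)
  show ?thesis using r s by (intro exI[of _ "r @ s"]) auto
qed

lemma C_unsat: "x \<in> C \<Longrightarrow> j < n \<Longrightarrow> x \<in> V j \<Longrightarrow> \<not> A \<subseteq> \<beta> j"
proof
  assume x: "x \<in> C" and j: "j < n" "x \<in> V j" and sub: "A \<subseteq> \<beta> j"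
  obtain u where u: "set u \<subseteq> A" "fold p u x = v" using C_back[OF x] by blast
  then have "v \<in> V j" using stay[OF j, of u] sub by auto
  then show False using unsat j sub by blast
qed

text \<open>The inclusion in \<open>A\<close> is strict, which brings
  \<open>\<beta> j \<inter> A\<close> below the bound and so within reach of
  \<open>retractable\<close>.\<close>

lemma C_card: "x \<in> C \<Longrightarrow> j < n \<Longrightarrow> x \<in> V j \<Longrightarrow> card (\<beta> j \<inter> A) < k"
proof -
  assume "x \<in> C" "j < n" "x \<in> V j"
  then have "\<beta> j \<inter> A \<subset> A" using C_unsat by blast
  then show ?thesis using psubset_card_mono[OF finA, of "\<beta> j \<inter> A"] cardA by linarith
qed

text \<open>By freeness \<open>q @ rev z\<close> is trivial in \<open>G\<close>, and it stays
  trivial when the letters outside \<open>\<beta> j \<inter> A\<close> are erased. Applied to a word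
  \<open>z\<close> over the common letters of two layers, this yields a connection inside
  \<open>A\<close> that can be used in either layer.\<close>

lemma gate:
  assumes j: "j < n" and x: "x \<in> C" "x \<in> V j"
    and q: "set q \<subseteq> \<beta> j \<inter> A" and z: "set z \<subseteq> \<beta> j" and eq: "fold p q x = fold p z x"
  shows "fold p (filter (\<lambda>e. e \<in> A) z) x = fold p q x"
proof -
  define z' where "z' = filter (\<lambda>e. e \<in> A) z"
  have sub: "\<beta> j \<subseteq> E" using letters[OF j] .
  have la: "acts (\<beta> j) (V j) p" using layer_acts[OF j] .
  have "fold p (q @ rev z) x = x" using eq acts_fold_rev[OF la z x(2)] by simp
  then have "val (q @ rev z) = \<one>" using free[OF j x(2), of "q @ rev z"] q z by auto
  then have "val (filter (\<lambda>e. e \<in> \<beta> j \<inter> A) (q @ rev z)) = \<one>"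
    using retr[unfolded retractable_def, rule_format, of "\<beta> j \<inter> A" "q @ rev z"]
      C_card[OF x(1) j x(2)] sub q z by auto
  moreover have "filter (\<lambda>e. e \<in> \<beta> j \<inter> A) q = q" using q by (auto simp: filter_id_conv)
  moreover have "filter (\<lambda>e. e \<in> \<beta> j \<inter> A) (rev z) = rev z'"
    unfolding z'_def rev_filter using z by (auto intro!: filter_cong)
  ultimately have 1: "val (q @ rev z') = \<one>" by simp
  have z': "set z' \<subseteq> \<beta> j" using z by (auto simp: z'_def)
  then have "fold p (q @ rev z') x = x" using 1 free[OF j x(2), of "q @ rev z'"] q by auto
  then have "fold p (rev z') (fold p q x) = x" by simp
  moreover have "fold p q x \<in> V j" using stay[OF j x(2)] q by auto
  ultimately have "fold p z' x = fold p q x" using acts_fold_rev'[OF la z'] by metis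
  then show ?thesis by (simp add: z'_def)
qed

lemma component_orbit:
  assumes j: "j < n" and x: "x \<in> V j \<inter> C" and y: "y \<in> V j \<inter> C"
  shows "\<exists>q. set q \<subseteq> \<beta> j \<inter> A \<and> fold p q x = y"
proof -
  define l where "l = (LEAST j. j < n \<and> V j \<inter> C \<noteq> {})"
  have "l < n \<and> V l \<inter> C \<noteq> {}" unfolding l_def by (rule LeastI[of _ j]) (use j x in auto)
  then obtain u where l: "l < n" and u: "u \<in> V l" "u \<in> C" by auto
  have least: "l \<le> i" if "i < n" "z \<in> V i" "z \<in> C" for i z
    unfolding l_def by (rule Least_le) (use that in auto)
  define D where "D = spread p A \<beta> V u l"
  have Dc: "fold p q z \<in> D m" if "z \<in> D m" "set q \<subseteq> \<beta> (l + m) \<inter> A" for m q z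
    using spread_closed that unfolding D_def by metis
  have up: "z \<in> D (Suc m)" if "z \<in> D m" "z \<in> V (l + Suc m)" for m z
    using that unfolding D_def by (auto intro!: exI[of _ "[]"])
  \<comment> \<open>In the induction step two entry points \<open>x0\<close>, \<open>y0\<close> of
    the next layer are connected by \<open>q\<close> inside \<open>A\<close>, because stage
    \<open>m\<close> is a single orbit, and by \<open>z\<close> in the overlap; \<open>gate\<close>
    turns the two into a connection by common letters in \<open>A\<close>.\<close>
  have A: "D m \<subseteq> V (l + m) \<inter> C \<and>
     (\<forall>x\<in>D m. \<forall>y\<in>D m. \<exists>q. set q \<subseteq> \<beta> (l + m) \<inter> A \<and> fold p q x = y)" if "l + m < n" for m
    using that
  proof (induction m)
    case 0
    show ?case
    proof (intro conjI ballI)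
      show "D 0 \<subseteq> V (l + 0) \<inter> C"
        using stay[OF l u(1)] C_closed[OF u(2)] by (auto simp: D_def)
      fix x y assume "x \<in> D 0" "y \<in> D 0"
      then obtain a b where "set a \<subseteq> \<beta> l \<inter> A" "x = fold p a u" "set b \<subseteq> \<beta> l \<inter> A" "y = fold p b u"
        by (auto simp: D_def)
      then show "\<exists>q. set q \<subseteq> \<beta> (l + 0) \<inter> A \<and> fold p q x = y"
        using acts_fold_rev[OF layer_acts[OF l] _ u(1), of a] by (intro exI[of _ "rev a @ b"]) auto
    qed
  next
    case (Suc m)
    have lm: "l + m < n" "l + Suc m < n" "Suc (l + m) < n" using Suc by auto
    have IH: "D m \<subseteq> V (l + m) \<inter> C"
      "\<And>x y. x \<in> D m \<Longrightarrow> y \<in> D m \<Longrightarrow> \<exists>q. set q \<subseteq> \<beta> (l + m) \<inter> A \<and> fold p q x = y"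
      using Suc.IH lm by blast+
    show ?case
    proof (intro conjI ballI)
      show "D (Suc m) \<subseteq> V (l + Suc m) \<inter> C"
      proof
        fix x assume "x \<in> D (Suc m)"
        then obtain a x0 where a: "set a \<subseteq> \<beta> (l + Suc m) \<inter> A" "x = fold p a x0" "x0 \<in> D m" "x0 \<in> V (l + Suc m)"
          by (auto simp: D_def)
        then show "x \<in> V (l + Suc m) \<inter> C" using IH stay[OF lm(2) a(4), of a] C_closed[of x0 a] by auto
      qed
      fix x y assume "x \<in> D (Suc m)" "y \<in> D (Suc m)"
      then obtain a x0 b y0 where
        a: "set a \<subseteq> \<beta> (l + Suc m) \<inter> A" "x = fold p a x0" "x0 \<in> D m" "x0 \<in> V (l + Suc m)" and
        b: "set b \<subseteq> \<beta> (l + Suc m) \<inter> A" "y = fold p b y0" "y0 \<in> D m" "y0 \<in> V (l + Suc m)"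
        by (auto simp: D_def)
      obtain q where q: "set q \<subseteq> \<beta> (l + m) \<inter> A" "fold p q x0 = y0" using IH(2) a b by blast
      obtain z where z: "set z \<subseteq> \<beta> (l + m) \<inter> \<beta> (l + Suc m)" "fold p z x0 = y0"
        using overlap[OF lm(3), of x0 y0] IH(1) a b by auto
      have x0: "x0 \<in> C" "x0 \<in> V (l + m)" using IH(1) a by auto
      have "fold p (filter (\<lambda>e. e \<in> A) z) x0 = y0"
        using gate[OF lm(1) x0 q(1), of z] z q by auto
      moreover have "fold p (rev a) x = x0"
        using acts_fold_rev[OF layer_acts[OF lm(2)] _ a(4), of a] a by auto
      ultimately have "fold p (rev a @ filter (\<lambda>e. e \<in> A) z @ b) x = y" using b by simp
      then show "\<exists>q. set q \<subseteq> \<beta> (l + Suc m) \<inter> A \<and> fold p q x = y"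
        using a b z by (intro exI[of _ "rev a @ filter (\<lambda>e. e \<in> A) z @ b"]) auto
    qed
  qed
  \<comment> \<open>A point that also lies in the layer below was already in the stage below, so
    coming back down produces nothing new.\<close>
  have down: "z \<in> D m" if z: "z \<in> D (Suc m)" "z \<in> V (l + m)" and m: "l + Suc m < n" for z m
  proof -
    obtain a x0 where a: "set a \<subseteq> \<beta> (l + Suc m) \<inter> A" "z = fold p a x0" "x0 \<in> D m" "x0 \<in> V (l + Suc m)"
      using z by (auto simp: D_def)
    have x0: "x0 \<in> C" "x0 \<in> V (l + m)" using A[of m] a m by auto
    have "z \<in> V (l + Suc m)" using stay[OF m a(4), of a] a by auto
    then obtain y where y: "set y \<subseteq> \<beta> (l + m) \<inter> \<beta> (l + Suc m)" "fold p y x0 = z"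
      using overlap[of "l + m" x0 z] m z x0 a by auto
    have "fold p (filter (\<lambda>e. e \<in> A) y) x0 = z"
      using gate[OF m x0(1) a(4) a(1), of y] y a by auto
    then show ?thesis using Dc[OF a(3), of "filter (\<lambda>e. e \<in> A) y"] y by auto
  qed
  \<comment> \<open>\<open>far\<close> leaves only the layer itself and its two neighbours as owners
    of \<open>e\<close> at \<open>z\<close>; in the third case the minimality of \<open>l\<close>
    guarantees that there is a stage below.\<close>
  have step: "\<exists>m'. l + m' < n \<and> p e z \<in> D m'" if z: "z \<in> D m" "l + m < n" and e: "e \<in> A" for e z m
  proof (cases "\<exists>j<n. z \<in> V j \<and> e \<in> \<beta> j")
    case True
    then obtain i where i: "i < n" "z \<in> V i" "e \<in> \<beta> i" by auto
    have zV: "z \<in> V (l + m)" "z \<in> C" using A[OF z(2)] z by auto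
    have "\<not> i + 2 \<le> l + m" using far[of i "l + m"] i zV z by blast
    moreover have "\<not> l + m + 2 \<le> i" using far[of "l + m" i] i zV z by blast
    ultimately consider "i = l + m" | "i = l + Suc m" | "Suc i = l + m" by linarith
    then show ?thesis
    proof cases
      case 1
      then show ?thesis using Dc[OF z(1), of "[e]"] i e z by auto
    next
      case 2
      then show ?thesis using Dc[OF up[OF z(1)], of "[e]"] i e z by (intro exI[of _ "Suc m"]) auto
    next
      case 3
      have "l \<le> i" using least i zV by blast
      define m' where "m' = i - l"
      have m': "i = l + m'" "m = Suc m'" using 3 \<open>l \<le> i\<close> by (auto simp: m'_def)
      then have "z \<in> D m'" using down z i by auto
      then show ?thesis using Dc[of z m' "[e]"] i e m' z by (intro exI[of _ m']) auto
    qed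
  next
    case False
    have "z \<in> V (l + m)" using A[OF z(2)] z by auto
    moreover have "e \<in> E" using AE e by auto
    ultimately have "p e z = z" by (rule fixed[OF z(2)]) (use False in simp)
    then show ?thesis using z by (intro exI[of _ m]) simp
  qed
  have reach: "\<exists>m'. l + m' < n \<and> fold p w z \<in> D m'" if "z \<in> D m" "l + m < n" "set w \<subseteq> A" for w z m
    using that
  proof (induction w arbitrary: z m)
    case (Cons e w)
    then have "e \<in> A" by simp
    then obtain m' where "l + m' < n" "p e z \<in> D m'" using step[OF Cons.prems(1,2)] by blast
    then show ?case using Cons.IH[of "p e z" m'] Cons.prems by simp
  qed auto
  have layer: "\<exists>m. j = l + m \<and> z \<in> D m" if zj: "z \<in> V j \<inter> C" for z
  proof -
    have "z \<in> C" using zj by simp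
    then obtain w where "set w \<subseteq> A" "fold p w u = z" using C_connected[OF u(2)] by blast
    moreover have "u \<in> D 0" by (auto simp: D_def intro!: exI[of _ "[]"])
    ultimately obtain m where m: "l + m < n" "z \<in> D m" using reach[of u 0 w] l by auto
    have zV: "z \<in> V (l + m)" using A[OF m(1)] m by auto
    have lj: "l \<le> j" using least j zj by blast
    have "\<not> j + 2 \<le> l + m" using far[of j "l + m"] zj zV m by blast
    moreover have "\<not> l + m + 2 \<le> j" using far[of "l + m" j] zj zV j by blast
    ultimately consider "j = l + m" | "j = l + Suc m" | "Suc j = l + m" by linarith
    then show ?thesis
    proof cases
      case 1
      then show ?thesis using m by blast
    next
      case 2
      then show ?thesis using up[OF m(2)] zj by blast
    next
      case 3
      define m' where "m' = j - l"
      have m': "j = l + m'" "m = Suc m'" using 3 lj by (auto simp: m'_def)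
      then show ?thesis using down[of z m'] m zj by auto
    qed
  qed
  obtain m where m: "j = l + m" "x \<in> D m" using layer x by blast
  then have "y \<in> D m" using layer y by auto
  then show ?thesis using A[of m] m j by blast
qed

text \<open>Layers missed by the component get the empty letter set, since the bound of
  \<open>C_card\<close> holds for layers that it meets. The overlap axiom for the reduced letters is
  again an application of \<open>gate\<close>.\<close>

lemma component_chain:
  defines "V' \<equiv> \<lambda>j. V j \<inter> C"
  defines "\<beta>' \<equiv> \<lambda>j. if V' j = {} then {} else \<beta> j \<inter> A"
  defines "p' \<equiv> \<lambda>e x. if e \<in> A then p e x else x"
  shows "chain E G \<iota> n V' \<beta>' p'" and "j < n \<Longrightarrow> card (\<beta>' j) < k"
proof -
  have fold': "fold p' w x = fold p w x" if "set w \<subseteq> A" for w x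
    using that by (induction w arbitrary: x) (auto simp: p'_def)
  have sub: "\<beta>' j \<subseteq> A" "\<beta>' j \<subseteq> \<beta> j" for j by (auto simp: \<beta>'_def)
  have foldb: "fold p' w x = fold p w x" if "set w \<subseteq> \<beta>' j" for w x j
    using fold' that sub by blast
  show "chain E G \<iota> n V' \<beta>' p'"
  proof (unfold_locales, goal_cases)
    case (1 i)
    then show ?case using sub letters by blast
  next
    case (2 i)
    show ?case
      unfolding acts_def
    proof (intro ballI)
      fix e x assume e: "e \<in> \<beta>' i" and x: "x \<in> V' i"
      have "e \<in> A" "e \<in> \<beta> i" using e sub by auto
      then show "p' e x \<in> V' i \<and> p' e (p' e x) = x"
        using x layer_acts[OF 2] C_closed[of x "[e]"] by (auto simp: V'_def p'_def acts_def)
    qed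
  next
    case (3 i x e)
    show ?case
    proof (cases "e \<in> A")
      case True
      have "p e x = x"
      proof (rule fixed[OF 3(1) _ 3(3)])
        show "x \<in> V i" using 3 by (simp add: V'_def)
        fix j assume "j < n" "x \<in> V j"
        then have "x \<in> V' j" using 3 by (simp add: V'_def)
        then show "e \<notin> \<beta> j" using 3(4)[OF \<open>j < n\<close>] True by (auto simp: \<beta>'_def split: if_splits)
      qed
      then show ?thesis by (simp add: p'_def)
    qed (simp add: p'_def)
  next
    case (4 i x w)
    have "fold p w x = x \<longleftrightarrow> val w = \<one>"
      using free[OF 4(1), of x w] 4 sub(2)[of i] by (auto simp: V'_def)
    then show ?case using foldb[OF 4(3)] by simp
  next
    case (5 i x y)
    obtain q where "set q \<subseteq> \<beta> i \<inter> A" "fold p q x = y"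
      using component_orbit[OF 5(1)] 5 by (auto simp: V'_def)
    moreover from this have "set q \<subseteq> \<beta>' i" using 5 by (auto simp: \<beta>'_def)
    ultimately show ?case using foldb by blast
  next
    case (6 i j)
    then show ?case using far[of i j] by (auto simp: V'_def)
  next
    case (7 i x y)
    have x: "x \<in> V i" "x \<in> C" "x \<in> V (Suc i)" and y: "y \<in> V i" "y \<in> C" "y \<in> V (Suc i)"
      using 7 by (auto simp: V'_def)
    have i: "i < n" using 7 by simp
    obtain q where q: "set q \<subseteq> \<beta> i \<inter> A" "fold p q x = y"
      using component_orbit[OF i] x y by blast
    obtain z where z: "set z \<subseteq> \<beta> i \<inter> \<beta> (Suc i)" "fold p z x = y"
      using overlap[OF 7(1), of x y] x y by auto
    have "fold p (filter (\<lambda>e. e \<in> A) z) x = y"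
      using gate[OF i x(2,1) q(1), of z] q z by auto
    moreover have "set (filter (\<lambda>e. e \<in> A) z) \<subseteq> \<beta>' i \<inter> \<beta>' (Suc i)"
      using z 7 by (auto simp: \<beta>'_def)
    ultimately show ?case using foldb[of _ i] by (intro exI[of _ "filter (\<lambda>e. e \<in> A) z"]) auto
  qed
  \<comment> \<open>This makes \<open>k\<close> positive, so that the empty letter sets meet the
    bound too.\<close>
  have "A \<noteq> {}" using unsat v by auto
  then have "k > 0" using cardA finA by (metis card_gt_0_iff less_le_trans)
  then show "j < n \<Longrightarrow> card (\<beta>' j) < k"
    using C_card by (auto simp: \<beta>'_def V'_def)
qed

end

text \<open>If one layer through \<open>v\<close> owns all letters of \<open>w\<close>, freeness
  suffices. Otherwise \<open>w\<close> moves \<open>v\<close> inside its component under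
  \<open>set w\<close>, a chain with letter sets smaller than \<open>k\<close>, where
  \<open>small\<close> applies.\<close>

lemma locally_compatible_chain:
  assumes finE: "finite E" and retr: "retractable E k G \<iota>"
    and small: "\<And>V \<beta> (p :: 'e \<Rightarrow> 'x \<Rightarrow> 'x). chain E G \<iota> n V \<beta> p \<Longrightarrow> (\<And>i. i < n \<Longrightarrow> card (\<beta> i) < k) \<Longrightarrow>
      globally_compatible E G \<iota> (\<Union>i<n. V i) p"
  shows "locally_compatible E k G \<iota> (\<Union>i<n. V i) p"
  unfolding locally_compatible_def
proof (intro allI impI ballI, elim conjE)
  fix w v assume w: "set w \<subseteq> E" "card (set w) \<le> k" "val w = \<one>" and v: "v \<in> (\<Union>i<n. V i)"
  show "fold p w v = v"
  proof (cases "\<exists>j<n. v \<in> V j \<and> set w \<subseteq> \<beta> j")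
    case True
    then show ?thesis using free w by blast
  next
    case False
    define C where "C = {fold p u v | u. set u \<subseteq> set w}"
    define V' where "V' = (\<lambda>j. V j \<inter> C)"
    define \<beta>' where "\<beta>' = (\<lambda>j. if V' j = {} then {} else \<beta> j \<inter> set w)"
    define p' where "p' = (\<lambda>e x. if e \<in> set w then p e x else x)"
    have ns: "\<And>j. j < n \<Longrightarrow> v \<in> V j \<Longrightarrow> \<not> set w \<subseteq> \<beta> j" using False by blast
    have "chain E G \<iota> n V' \<beta>' p'" "\<And>j. j < n \<Longrightarrow> card (\<beta>' j) < k"
      unfolding p'_def \<beta>'_def V'_def C_def
      using component_chain[OF _ w(1,2) retr v ns] by simp_all
    then have "globally_compatible E G \<iota> (\<Union>i<n. V' i) p'" using small by blast
    moreover have "v \<in> C" by (auto simp: C_def intro!: exI[of _ "[]"])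
    then have "v \<in> (\<Union>i<n. V' i)" using v by (auto simp: V'_def)
    ultimately have "fold p' w v = v" using w unfolding globally_compatible_def by blast
    moreover have "fold p' u x = fold p u x" if "set u \<subseteq> set w" for u x
      using that by (induction u arbitrary: x) (auto simp: p'_def)
    ultimately show ?thesis by simp
  qed
qed

end

section \<open>Completing the constraint graph for a set of letters\<close>

lemma walk_append: "walk R s (u @ v) t \<longleftrightarrow> (\<exists>x. walk R s u x \<and> walk R x v t)"
  by (induction u arbitrary: s) auto

lemma walk_rev:
  "E_graph E S R \<Longrightarrow> set w \<subseteq> E \<Longrightarrow> walk R s w t \<Longrightarrow> walk R t (rev w) s"
proof (induction w arbitrary: s)
  case (Cons e w)
  then obtain x where x: "(s, x) \<in> R e" "walk R t (rev w) x" by auto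
  then have "(x, s) \<in> R e" using Cons by (auto simp: E_graph_def sym_def)
  then show ?case using x by (auto simp: walk_append)
qed auto

lemma walk_end:
  "E_graph E S R \<Longrightarrow> set w \<subseteq> E \<Longrightarrow> s \<in> S \<Longrightarrow> walk R s w t \<Longrightarrow> t \<in> S"
  by (induction w arbitrary: s) (fastforce simp: E_graph_def)+

lemma pi_e_edge: "E_graph E S R \<Longrightarrow> e \<in> E \<Longrightarrow> (s, t) \<in> R e \<Longrightarrow> pi_e R e s = t"
  unfolding pi_e_def E_graph_def by (auto intro!: the_equality)

lemma acts_pi_e:
  assumes "E_graph E S R"
  shows "acts E S (pi_e R)"
  unfolding acts_def
proof (intro ballI)
  fix e s assume e: "e \<in> E" and s: "s \<in> S"
  show "pi_e R e s \<in> S \<and> pi_e R e (pi_e R e s) = s"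
  proof (cases "\<exists>t. (s, t) \<in> R e")
    case True
    then obtain t where t: "(s, t) \<in> R e" by blast
    then have "(t, s) \<in> R e" "t \<in> S" using assms e by (auto simp: E_graph_def sym_def)
    then show ?thesis using pi_e_edge[OF assms e] t by simp
  qed (simp add: pi_e_def s)
qed

lemma fold_pi_e_walk:
  "E_graph E S R \<Longrightarrow> set w \<subseteq> E \<Longrightarrow> walk R s w t \<Longrightarrow> fold (pi_e R) w s = t"
  by (induction w arbitrary: s) (auto simp: pi_e_edge)

lemma pi_w_fold: "pi_w R w v = fold (pi_e R) w v"
proof -
  have "fold (\<lambda>e f. pi_e R e \<circ> f) w g v = fold (pi_e R) w (g v)" for g
    by (induction w arbitrary: g) auto
  then show ?thesis by (simp add: pi_w_def)
qed

definition walk_retractable ::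
  "'e set \<Rightarrow> nat \<Rightarrow> 'v set \<Rightarrow> ('e \<Rightarrow> ('v \<times> 'v) set) \<Rightarrow> ('g, 'b) monoid_scheme \<Rightarrow> ('e \<Rightarrow> 'g) \<Rightarrow> bool" where
  "walk_retractable E k S R G \<iota> \<longleftrightarrow>
    (\<forall>A s t w u. A \<subseteq> E \<and> card A < k \<and> s \<in> S \<and> set w \<subseteq> E \<and> walk R s w t \<and> set u \<subseteq> A \<and>
       wval G \<iota> w = wval G \<iota> u \<longrightarrow> (\<exists>q. set q \<subseteq> A \<and> walk R s q t \<and> wval G \<iota> q = wval G \<iota> u))"

text \<open>The constraint graph with every component of \<open>A\<close>-edges extended so that all letters of \<open>A\<close>
  act as in \<open>G\<close>; the other letters act by \<open>pi_e\<close> on the constraint graph and trivially elsewhere.\<close>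

locale completion = egrp E G \<iota>
  for E :: "'e set" and G :: "('g, 'b) monoid_scheme" (structure) and \<iota> :: "'e \<Rightarrow> 'g" +
  fixes S :: "'v set" and R :: "'e \<Rightarrow> ('v \<times> 'v) set" and A :: "'e set"
    and W :: "'x set" and p :: "'e \<Rightarrow> 'x \<Rightarrow> 'x" and s :: "'v \<Rightarrow> 'x"
  assumes graph: "E_graph E S R" and AE: "A \<subseteq> E" and acts_p: "acts E W p"
    and trivial: "v \<in> W \<Longrightarrow> set w \<subseteq> A \<Longrightarrow> wval G \<iota> w = \<one> \<Longrightarrow> fold p w v = v"
    and s_in: "x \<in> S \<Longrightarrow> s x \<in> W" and s_inj: "inj_on s S"
    and other: "x \<in> S \<Longrightarrow> e \<in> E - A \<Longrightarrow> p e (s x) = s (pi_e R e x)"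
    and off: "v \<in> W - s ` S \<Longrightarrow> e \<in> E - A \<Longrightarrow> p e v = v"
    and real: "e \<in> A \<Longrightarrow> (x, y) \<in> R e \<Longrightarrow> p e (s x) = s y"
    and return: "x \<in> S \<Longrightarrow> y \<in> S \<Longrightarrow> set u \<subseteq> A \<Longrightarrow> fold p u (s x) = s y \<Longrightarrow>
       \<exists>q. set q \<subseteq> A \<and> walk R x q y \<and> wval G \<iota> q = wval G \<iota> u"
    and generated: "v \<in> W \<Longrightarrow> \<exists>x\<in>S. \<exists>u. set u \<subseteq> A \<and> v = fold p u (s x)"
begin

lemma card_completion:
  assumes "finite S" "finite (carrier G)"
  shows "finite W \<and> card W \<le> card S * card (carrier G)"
proof -
  define h where "h = (\<lambda>(x, g). fold p (SOME u. set u \<subseteq> A \<and> val u = g) (s x))"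
  have "W \<subseteq> h ` (S \<times> carrier G)"
  proof
    fix v assume "v \<in> W"
    then obtain x u where x: "x \<in> S" "set u \<subseteq> A" "v = fold p u (s x)" using generated by blast
    define u' where "u' = (SOME u'. set u' \<subseteq> A \<and> val u' = val u)"
    have u': "set u' \<subseteq> A \<and> val u' = val u"
      unfolding u'_def by (rule someI[of _ u]) (use x in simp)
    then have "val (u @ rev u') = \<one>" using x AE val_eq_iff[of u u'] by auto
    then have "fold p (u @ rev u') (s x) = s x" using trivial[OF s_in[OF x(1)], of "u @ rev u'"] x u' by auto
    then have "fold p (rev u') v = s x" using x by simp
    moreover have "set u' \<subseteq> E" using u' AE by blast
    ultimately have "fold p u' (s x) = v" using acts_fold_rev'[OF acts_p _ \<open>v \<in> W\<close>, of u'] by simp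
    then have "h (x, val u) = v" unfolding h_def u'_def by simp
    moreover have "val u \<in> carrier G" using x AE by auto
    ultimately show "v \<in> h ` (S \<times> carrier G)" using x by force
  qed
  then show ?thesis using assms
    by (metis card_cartesian_product card_image_le card_mono finite_SigmaI finite_imageI finite_subset le_trans)
qed

lemma fold_walk: "x \<in> S \<Longrightarrow> set w \<subseteq> E \<Longrightarrow> walk R x w y \<Longrightarrow> fold p w (s x) = s y"
proof (induction w arbitrary: x)
  case (Cons e w)
  then obtain z where z: "(x, z) \<in> R e" "walk R z w y" by auto
  have "z \<in> S" using z Cons graph by (auto simp: E_graph_def)
  moreover have "p e (s x) = s z"
    using real[OF _ z(1)] other[of x e] pi_e_edge[OF graph _ z(1)] Cons.prems by (cases "e \<in> A") auto
  ultimately show ?case using Cons z by simp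
qed simp

text \<open>The letters in \<open>A - D\<close> lose their extended action and fall back to
  \<open>pi_e\<close>. The delicate axiom is \<open>return\<close>: the larger completion provides
  only a walk over \<open>A\<close>, and \<open>walk_retractable\<close> replaces its label by one
  over \<open>D\<close>.\<close>

lemma subcompletion:
  assumes D: "D \<subseteq> A" "card D < k" and wr: "walk_retractable E k S R G \<iota>"
  defines "W' \<equiv> {fold p z (s x) | z x. set z \<subseteq> D \<and> x \<in> S}"
  defines "p' \<equiv> \<lambda>e v. if e \<in> D then p e v else if v \<in> s ` S then s (pi_e R e (inv_into S s v)) else v"
  shows "completion E G \<iota> S R D W' p' s"
proof -
  have DE: "D \<subseteq> E" using D AE by blast
  have sub: "W' \<subseteq> W" using acts_fold[OF acts_p] s_in DE by (auto simp: W'_def)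
  have sW: "s x \<in> W'" if "x \<in> S" for x
    using that by (auto simp: W'_def intro!: exI[of _ "[]"])
  have fold': "fold p' w v = fold p w v" if "set w \<subseteq> D" for w v
    using that by (induction w arbitrary: v) (auto simp: p'_def)
  have p's: "p' e (s x) = s (pi_e R e x)" if "x \<in> S" "e \<notin> D" for e x
    using that s_inj by (auto simp: p'_def)
  show ?thesis
  proof (unfold_locales, goal_cases)
    case 3
    show ?case
      unfolding acts_def
    proof (intro ballI)
      fix e v assume e: "e \<in> E" and v: "v \<in> W'"
      show "p' e v \<in> W' \<and> p' e (p' e v) = v"
      proof (cases "e \<in> D")
        case True
        obtain z x where z: "set z \<subseteq> D" "x \<in> S" "v = fold p z (s x)" using v by (auto simp: W'_def)
        then have "p e v \<in> W'" using True by (auto simp: W'_def intro!: exI[of _ "z @ [e]"] exI[of _ x])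
        moreover have "p e (p e v) = v" using v sub e acts_p by (auto simp: acts_def)
        ultimately show ?thesis using True by (simp add: p'_def)
      next
        case False
        show ?thesis
        proof (cases "v \<in> s ` S")
          case True
          then obtain x where x: "x \<in> S" "v = s x" by auto
          have "pi_e R e x \<in> S" "pi_e R e (pi_e R e x) = x"
            using acts_pi_e[OF graph] e x by (auto simp: acts_def)
          then show ?thesis using p's[OF _ False] x sW by simp
        next
          case out: False
          then show ?thesis using v False by (simp add: p'_def)
        qed
      qed
    qed
  next
    case (4 v w)
    have "set w \<subseteq> A" using 4 D by blast
    then have "fold p w v = v" using trivial[of v w] 4 sub by blast
    then show ?case using fold' 4 by simp
  next
    case (10 x y u)
    then have u: "set u \<subseteq> A" "fold p u (s x) = s y" using D fold'[of u] by auto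
    obtain q where q: "set q \<subseteq> A" "walk R x q y" "val q = val u" using return[OF 10(1,2) u] by blast
    have "set q \<subseteq> E" using q AE by blast
    then show ?case using wr[unfolded walk_retractable_def, rule_format, of D x q y u] DE D 10 q by blast
  next
    case (11 v)
    then obtain z x where "set z \<subseteq> D" "x \<in> S" "v = fold p z (s x)" by (auto simp: W'_def)
    then show ?case using fold' by metis
  qed (use graph DE sW s_inj p's real D in \<open>auto simp: p'_def\<close>)
qed

lemma locally_compatible_completion:
  assumes finE: "finite E" and retr: "retractable E k G \<iota>" and wr: "walk_retractable E k S R G \<iota>"
    and cardA: "card A \<le> k"
    and small: "\<And>A W (p :: 'e \<Rightarrow> 'x \<Rightarrow> 'x) s. completion E G \<iota> S R A W p s \<Longrightarrow> card A < k \<Longrightarrow>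
      globally_compatible E G \<iota> W p"
  shows "locally_compatible E k G \<iota> W p"
  unfolding locally_compatible_def
proof (intro allI impI ballI, elim conjE)
  fix w v assume w: "set w \<subseteq> E" "card (set w) \<le> k" "val w = \<one>" and v: "v \<in> W"
  show "fold p w v = v"
  proof (cases "set w \<subseteq> A")
    case True
    then show ?thesis using trivial v w by blast
  next
    case False
    \<comment> \<open>As \<open>w\<close> is not a word over \<open>A\<close>, this is a proper
      subset of \<open>set w\<close> and has fewer than \<open>k\<close> letters. The letters of
      \<open>w\<close> outside \<open>D\<close> are outside \<open>A\<close> and so move only
      vertices of the constraint graph.\<close>
    define D where "D = A \<inter> set w"
    have "D \<subset> set w" using False by (auto simp: D_def)
    then have cD: "card D < k" using psubset_card_mono[of "set w" D] w by simp
    have DE: "D \<subseteq> E" "D \<subseteq> A" using AE by (auto simp: D_def)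
    define W' where "W' = {fold p z (s x) | z x. set z \<subseteq> D \<and> x \<in> S}"
    show ?thesis
    proof (cases "v \<in> W'")
      case True
      define p' where "p' = (\<lambda>e v. if e \<in> D then p e v else if v \<in> s ` S then s (pi_e R e (inv_into S s v)) else v)"
      have comp: "completion E G \<iota> S R D W' p' s"
        unfolding W'_def p'_def by (rule subcompletion[OF DE(2) cD wr])
      interpret c: completion E G \<iota> S R D W' p' s by (rule comp)
      have sub: "W' \<subseteq> W" using acts_fold[OF acts_p] s_in DE by (auto simp: W'_def)
      \<comment> \<open>On \<open>W'\<close> the letters of \<open>w\<close> act as in the
        completion for \<open>D\<close>, to which \<open>small\<close> applies.\<close>
      have "fold p w v = fold p' w v"
      proof (rule fold_agree[OF _ True])
        fix e x assume e: "e \<in> set w" and x: "x \<in> W'"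
        have "p e x = p' e x"
        proof (cases "e \<in> D")
          case False
          then have eA: "e \<in> E - A" using e w by (auto simp: D_def)
          show ?thesis
          proof (cases "x \<in> s ` S")
            case True
            then obtain y where "y \<in> S" "x = s y" by auto
            then show ?thesis using other[OF _ eA] c.other[of y e] eA False by auto
          next
            case out: False
            then show ?thesis using off[OF _ eA] x sub False by (auto simp: p'_def)
          qed
        qed (simp add: p'_def)
        moreover have "p' e x \<in> W'" using c.acts_p e w x by (auto simp: acts_def)
        ultimately show "p e x = p' e x \<and> p' e x \<in> W'" by simp
      qed
      also have "\<dots> = v" using small[OF comp cD] w True by (auto simp: globally_compatible_def)
      finally show ?thesis .
    next
      case False
      \<comment> \<open>Here the orbit of \<open>v\<close> under \<open>D\<close> avoids the
        constraint graph, so the letters of \<open>w\<close> outside \<open>D\<close> act trivially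
        along the way and may be erased; what remains is trivial in \<open>G\<close> by
        \<open>retr\<close>.\<close>
      define U where "U = {fold p z v | z. set z \<subseteq> D}"
      have U: "U \<subseteq> W" using acts_fold[OF acts_p _ v] DE by (auto simp: U_def)
      have out: "x \<notin> s ` S" if x: "x \<in> U" for x
      proof
        assume "x \<in> s ` S"
        then obtain y z where yz: "y \<in> S" "fold p z v = s y" "set z \<subseteq> D" using x by (auto simp: U_def)
        then have "fold p (rev z) (s y) = v" using acts_fold_rev[OF acts_p _ v, of z] DE by auto
        then have "v \<in> W'" using yz by (auto simp: W'_def intro!: exI[of _ "rev z"] exI[of _ y])
        then show False using \<open>v \<notin> W'\<close> by blast
      qed
      have "fold p w v = fold p (filter (\<lambda>e. e \<in> D) w) v"
      proof (rule fold_filter[where V=U])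
        show "v \<in> U" by (auto simp: U_def intro!: exI[of _ "[]"])
        fix e x assume e: "e \<in> set w" and x: "x \<in> U"
        have nofix: "p e x = x" if "e \<notin> D"
          using off[of x e] out[OF x] U x that e w by (auto simp: D_def)
        have "p e x \<in> U"
        proof (cases "e \<in> D")
          case True
          obtain z where "x = fold p z v" "set z \<subseteq> D" using x by (auto simp: U_def)
          then show ?thesis using True by (auto simp: U_def intro!: exI[of _ "z @ [e]"])
        next
          case False
          then show ?thesis using nofix x by simp
        qed
        then show "p e x \<in> U \<and> (e \<notin> D \<longrightarrow> p e x = x)" using nofix by blast
      qed
      also have "\<dots> = v"
      proof (rule trivial[OF v])
        show "set (filter (\<lambda>e. e \<in> D) w) \<subseteq> A" using DE by auto
        show "val (filter (\<lambda>e. e \<in> D) w) = \<one>"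
          using retr DE cD w unfolding retractable_def by blast
      qed
      finally show ?thesis .
    qed
  qed
qed

end

section \<open>Existence of completions, and walks with labels in \<open>G[A]\<close> or
  \<open>G[A] G[B]\<close>\<close>

context egrp
begin

text \<open>The completion is the quotient of \<open>S \<times> G[A]\<close> that identifies
  \<open>(x, val q \<otimes> h)\<close> with \<open>(y, h)\<close> whenever a word \<open>q\<close>
  over \<open>A\<close> labels a walk from \<open>x\<close> to \<open>y\<close>; right
  multiplication by letters of \<open>A\<close> descends to it.\<close>

lemma completion_exists:
  fixes S :: "'v set" and R :: "'e \<Rightarrow> ('v \<times> 'v) set"
  assumes graph: "E_graph E S R" and comp: "compatible E S R G \<iota>" and AE: "A \<subseteq> E"
  obtains W :: "('v \<times> 'g) set set" and p and s where "completion E G \<iota> S R A W p s"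
proof -
  define cls where "cls x g =
    {(y, h). y \<in> S \<and> h \<in> carrier G \<and> (\<exists>q. set q \<subseteq> A \<and> walk R x q y \<and> g = val q \<otimes> h)}" for x g
  define W where "W = {cls x (val u) | x u. x \<in> S \<and> set u \<subseteq> A}"
  define s where "s x = cls x \<one>" for x
  define p where "p e C = (if e \<in> A then (\<lambda>(y, h). (y, h \<otimes> \<iota> e)) ` C
     else if C \<in> s ` S then s (pi_e R e (inv_into S s C)) else C)" for e C
  have wE: "set q \<subseteq> E" if "set q \<subseteq> A" for q using that AE by blast
  have cls_sub: "cls y h \<subseteq> cls x g"
    if "x \<in> S" "y \<in> S" "g \<in> carrier G" "h \<in> carrier G" "set q \<subseteq> A" "walk R x q y" "g = val q \<otimes> h"
    for x y g h q
  proof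
    fix c assume "c \<in> cls y h"
    then obtain z k r where c: "c = (z, k)" "z \<in> S" "k \<in> carrier G" "set r \<subseteq> A" "walk R y r z"
      "h = val r \<otimes> k" by (auto simp: cls_def)
    have "walk R x (q @ r) z" using that c by (auto simp: walk_append)
    moreover have "g = val (q @ r) \<otimes> k" using that c wE by (simp add: m_assoc)
    ultimately show "c \<in> cls x g" using c that by (auto simp: cls_def intro!: exI[of _ "q @ r"])
  qed
  have cls_eq: "cls x g = cls y h \<longleftrightarrow> (\<exists>q. set q \<subseteq> A \<and> walk R x q y \<and> g = val q \<otimes> h)"
    if x: "x \<in> S" "y \<in> S" "g \<in> carrier G" "h \<in> carrier G" for x y g h
  proof
    assume eq: "cls x g = cls y h"
    have "(y, h) \<in> cls y h" using x by (auto simp: cls_def intro!: exI[of _ "[]"])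
    then have "(y, h) \<in> cls x g" using eq by simp
    then show "\<exists>q. set q \<subseteq> A \<and> walk R x q y \<and> g = val q \<otimes> h" by (auto simp: cls_def)
  next
    assume "\<exists>q. set q \<subseteq> A \<and> walk R x q y \<and> g = val q \<otimes> h"
    then obtain q where q: "set q \<subseteq> A" "walk R x q y" "g = val q \<otimes> h" by blast
    have 1: "walk R y (rev q) x" using walk_rev[OF graph wE] q by blast
    have 2: "h = val (rev q) \<otimes> g"
      unfolding val_rev[OF wE[OF q(1)]]
      by (rule iffD2[OF inv_solve_left[OF x(4) val_closed[OF wE[OF q(1)]] x(3)] q(3)])
    have "cls x g \<subseteq> cls y h" by (rule cls_sub[OF x(2,1,4,3) _ 1 2]) (use q in simp)
    moreover have "cls y h \<subseteq> cls x g" by (rule cls_sub[OF x q])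
    ultimately show "cls x g = cls y h" by blast
  qed
  have pA: "p e (cls x g) = cls x (g \<otimes> \<iota> e)" if e: "e \<in> A" and x: "x \<in> S" "g \<in> carrier G" for e x g
  proof -
    have ie: "\<iota> e \<in> carrier G" "\<iota> e \<otimes> \<iota> e = \<one>" using e AE gen_closed gen_sq by auto
    have fwd: "(y, h \<otimes> \<iota> e) \<in> cls x (g \<otimes> \<iota> e)" if yh: "(y, h) \<in> cls x g" for y h g
    proof -
      obtain q where q: "y \<in> S" "h \<in> carrier G" "set q \<subseteq> A" "walk R x q y" "g = val q \<otimes> h"
        using yh by (auto simp: cls_def)
      have "g \<otimes> \<iota> e = val q \<otimes> (h \<otimes> \<iota> e)"
        unfolding q(5) using q(2) ie wE[OF q(3)] by (simp add: m_assoc)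
      moreover have "h \<otimes> \<iota> e \<in> carrier G" using q(2) ie by simp
      ultimately show ?thesis using q(1,3,4) unfolding cls_def by blast
    qed
    have "cls x (g \<otimes> \<iota> e) \<subseteq> (\<lambda>(y, h). (y, h \<otimes> \<iota> e)) ` cls x g"
    proof
      fix c assume c: "c \<in> cls x (g \<otimes> \<iota> e)"
      obtain y h where yh: "c = (y, h)" by force
      have h: "h \<in> carrier G" using c yh by (auto simp: cls_def)
      have "(y, h \<otimes> \<iota> e) \<in> cls x (g \<otimes> \<iota> e \<otimes> \<iota> e)" using fwd c yh x ie by auto
      then have "(y, h \<otimes> \<iota> e) \<in> cls x g" using x ie by (simp add: m_assoc)
      moreover have "h \<otimes> \<iota> e \<otimes> \<iota> e = h" using h ie by (simp add: m_assoc)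
      ultimately show "c \<in> (\<lambda>(y, h). (y, h \<otimes> \<iota> e)) ` cls x g" using yh by force
    qed
    then show ?thesis using fwd x e by (auto simp: p_def)
  qed
  have fold_p: "fold p w (cls x g) = cls x (g \<otimes> val w)" if "set w \<subseteq> A" "x \<in> S" "g \<in> carrier G" for w x g
    using that
  proof (induction w arbitrary: g)
    case (Cons e w)
    then have "\<iota> e \<in> carrier G" using AE gen_closed by auto
    then show ?case using Cons wE[of w] by (simp add: pA m_assoc)
  qed simp
  \<comment> \<open>Compatibility with the constraint graph enters here: identified vertices are
    joined by a walk whose label is trivial in \<open>G\<close> and therefore fixes every
    vertex.\<close>
  have s_inj: "inj_on s S"
  proof (rule inj_onI)
    fix x y assume xy: "x \<in> S" "y \<in> S" "s x = s y"
    then obtain q where q: "set q \<subseteq> A" "walk R x q y" "\<one> = val q \<otimes> \<one>"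
      using cls_eq[of x y \<one> \<one>] by (auto simp: s_def)
    then have "val q = \<one>" using wE[OF q(1)] by simp
    then have "pi_w R q x = x" using comp wE[OF q(1)] xy by (auto simp: compatible_def)
    then show "x = y" using fold_pi_e_walk[OF graph wE[OF q(1)] q(2)] by (simp add: pi_w_fold)
  qed
  have sW: "s x \<in> W" if "x \<in> S" for x
    using that by (auto simp: s_def W_def intro!: exI[of _ x] exI[of _ "[]"])
  have ps: "p e (s x) = s (pi_e R e x)" if "x \<in> S" "e \<notin> A" for e x
    using that s_inj by (auto simp: p_def)
  have "completion E G \<iota> S R A W p s"
  proof (unfold_locales, goal_cases)
    case 3
    show ?case
      unfolding acts_def
    proof (intro ballI)
      fix e v assume e: "e \<in> E" and v: "v \<in> W"
      obtain x u where x: "x \<in> S" "set u \<subseteq> A" "v = cls x (val u)" using v by (auto simp: W_def)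
      show "p e v \<in> W \<and> p e (p e v) = v"
      proof (cases "e \<in> A")
        case True
        have "p e v = cls x (val (u @ [e]))"
          using x True wE[OF x(2)] e gen_closed by (simp add: pA)
        moreover have "p e (cls x (val (u @ [e]))) = v"
          using x True wE[OF x(2)] e gen_closed gen_sq by (simp add: pA m_assoc)
        moreover have "cls x (val (u @ [e])) \<in> W" unfolding W_def using x True
          by (intro CollectI exI[of _ x] exI[of _ "u @ [e]"]) simp
        ultimately show ?thesis by simp
      next
        case False
        show ?thesis
        proof (cases "v \<in> s ` S")
          case True
          then obtain y where y: "y \<in> S" "v = s y" by auto
          have "pi_e R e y \<in> S" "pi_e R e (pi_e R e y) = y"
            using acts_pi_e[OF graph] e y by (auto simp: acts_def)
          then show ?thesis using ps[OF _ False] y sW by simp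
        next
          case out: False
          then show ?thesis using v False by (simp add: p_def)
        qed
      qed
    qed
  next
    case (4 v w)
    then obtain x u where x: "x \<in> S" "set u \<subseteq> A" "v = cls x (val u)" by (auto simp: W_def)
    then show ?case using 4 fold_p[of w x "val u"] wE[OF x(2)] by simp
  next
    case (7 x e)
    then show ?case using ps by simp
  next
    case (9 e x y)
    have eE: "e \<in> E" using 9 AE by auto
    then have xy: "x \<in> S" "y \<in> S" using 9 graph by (auto simp: E_graph_def)
    have "cls x (\<iota> e) = cls y \<one>"
      using cls_eq[of x y "\<iota> e" \<one>] xy 9 gen_closed[OF eE] by (auto intro!: exI[of _ "[e]"])
    then show ?case using pA[of e x \<one>] 9 xy gen_closed[OF eE] by (simp add: s_def)
  next
    case (10 x y u)
    then have "cls x (val u) = cls y \<one>" using fold_p[of u x \<one>] wE[of u] by (simp add: s_def)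
    then obtain q where q: "set q \<subseteq> A" "walk R x q y" "val u = val q \<otimes> \<one>"
      using cls_eq[of x y "val u" \<one>] 10 wE[of u] by auto
    then show ?case using wE[OF q(1)] by auto
  next
    case (11 v)
    then obtain x u where x: "x \<in> S" "set u \<subseteq> A" "v = cls x (val u)" by (auto simp: W_def)
    then show ?case using fold_p[of u x \<one>] wE[OF x(2)] by (auto simp: s_def intro!: bexI[of _ x] exI[of _ u])
  qed (use graph AE sW s_inj in \<open>auto simp: p_def\<close>)
  then show thesis using that by blast
qed

text \<open>In the completion for \<open>A\<close>, words labelling walks stay inside the constraint graph, and a word
  over \<open>A\<close> not equal in \<open>G\<close> to one labelling a walk leaves it.\<close>

context
  fixes S :: "'v set" and R :: "'e \<Rightarrow> ('v \<times> 'v) set" and k :: nat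
  assumes graph: "E_graph E S R" and comp: "compatible E S R G \<iota>"
    and completions: "\<And>A W (p :: 'e \<Rightarrow> ('v \<times> 'g) set \<Rightarrow> ('v \<times> 'g) set) s. completion E G \<iota> S R A W p s \<Longrightarrow>
      card A < k \<Longrightarrow> globally_compatible E G \<iota> W p"
begin

lemma walk_in_completion:
  fixes p :: "'e \<Rightarrow> ('v \<times> 'g) set \<Rightarrow> ('v \<times> 'g) set"
  assumes c: "completion E G \<iota> S R A W p s" and "card A < k"
    and w: "set w \<subseteq> E" "x \<in> S" "walk R x w y" and u: "set u \<subseteq> E" "val w = val u"
  shows "fold p u (s x) = s y"
proof -
  interpret completion E G \<iota> S R A W p s by (rule c)
  have "val (w @ rev u) = \<one>" using w u val_eq_iff by blast
  moreover have "globally_compatible E G \<iota> W p" using completions[OF c] assms by blast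
  ultimately have "fold p (w @ rev u) (s x) = s x"
    using w u s_in unfolding globally_compatible_def by (metis le_sup_iff set_append set_rev)
  then have "fold p (rev u) (s y) = s x" using fold_walk[of x w y] w by simp
  moreover have "s y \<in> W" using walk_end[OF graph] w s_in by blast
  ultimately show ?thesis using acts_fold_rev'[OF acts_p u(1), of "s y"] by simp
qed

lemma walk_retractable: "walk_retractable E k S R G \<iota>"
  unfolding walk_retractable_def
proof (intro allI impI, elim conjE)
  fix A x y w u
  assume A: "A \<subseteq> E" "card A < k" and w: "x \<in> S" "set w \<subseteq> E" "walk R x w y"
    and u: "set u \<subseteq> A" "val w = val u"
  obtain W :: "('v \<times> 'g) set set" and p s where c: "completion E G \<iota> S R A W p s"
    using completion_exists[OF graph comp A(1)] .
  interpret completion E G \<iota> S R A W p s by (rule c)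
  have "fold p u (s x) = s y" using walk_in_completion[OF c A(2) w(2,1,3)] u A by blast
  then show "\<exists>q. set q \<subseteq> A \<and> walk R x q y \<and> val q = val u"
    using return walk_end[OF graph w(2,1,3)] w(1) u by blast
qed

text \<open>In the completion for \<open>A\<close>, the word \<open>u\<close> leads from
  \<open>s x\<close> to a point \<open>b\<close>, from where \<open>v\<close> leads to
  \<open>s y\<close>. If letters of \<open>A \<inter> B\<close> bring \<open>b\<close> back into the
  constraint graph, the vertex reached there is the required \<open>z\<close>.\<close>

lemma walk_product:
  assumes A: "A \<subseteq> E" "card A < k" and B: "B \<subseteq> E" "card B < k"
    and w: "set w \<subseteq> E" "x \<in> S" "walk R x w y"
    and u: "set u \<subseteq> A" and v: "set v \<subseteq> B" and eq: "val w = val u \<otimes> val v"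
  obtains q z r where "set q \<subseteq> A" "walk R x q z" "set r \<subseteq> B" "walk R z r y" "val w = val q \<otimes> val r"
proof -
  obtain W :: "('v \<times> 'g) set set" and p s where c: "completion E G \<iota> S R A W p s"
    using completion_exists[OF graph comp A(1)] .
  interpret completion E G \<iota> S R A W p s by (rule c)
  have uE: "set u \<subseteq> E" and vE: "set v \<subseteq> E" using u v A B by auto
  define b where "b = fold p u (s x)"
  have b: "b \<in> W" using acts_fold[OF acts_p uE] s_in w by (simp add: b_def)
  have "fold p (u @ v) (s x) = s y"
    by (rule walk_in_completion[OF c A(2) w]) (use uE vE eq in auto)
  then have bv: "fold p v b = s y" by (simp add: b_def)
  have yS: "y \<in> S" using walk_end[OF graph w] .
  show thesis
  proof (cases "\<exists>d z. set d \<subseteq> A \<inter> B \<and> z \<in> S \<and> fold p d b = s z")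
    case True
    then obtain d z where d: "set d \<subseteq> A \<inter> B" "z \<in> S" "fold p d b = s z" by blast
    have dE: "set d \<subseteq> E" using d A by auto
    have "fold p (u @ d) (s x) = s z" using d by (simp add: b_def)
    then obtain q where q: "set q \<subseteq> A" "walk R x q z" "val q = val (u @ d)"
      using return[OF w(2) d(2), of "u @ d"] u d by auto
    have qE: "set q \<subseteq> E" using q A by auto
    \<comment> \<open>Going back along \<open>q\<close> and then along \<open>w\<close> is a walk
      from \<open>z\<close> to \<open>y\<close>, and its label has the value of
      \<open>rev d @ v\<close>, a word over \<open>B\<close>.\<close>
    have "walk R z (rev q) x" using walk_rev[OF graph qE q(2)] .
    then have "walk R z (rev q @ w) y" using w by (auto simp: walk_append)
    moreover have "val (rev q @ w) = val (rev d @ v)"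
    proof -
      have "val (rev q @ w) = inv (val u \<otimes> val d) \<otimes> (val u \<otimes> val v)"
        using q(3) qE uE dE w(1) eq by (simp add: val_rev)
      also have "\<dots> = inv (val d) \<otimes> (inv (val u) \<otimes> (val u \<otimes> val v))"
        using uE dE vE by (simp add: inv_mult_group m_assoc)
      also have "inv (val u) \<otimes> (val u \<otimes> val v) = val v"
        using uE vE by (simp add: m_assoc[symmetric])
      finally show ?thesis using dE vE by (simp add: val_rev)
    qed
    moreover have "set (rev q @ w) \<subseteq> E" "set (rev d @ v) \<subseteq> B" using qE w d v by auto
    ultimately obtain r where r: "set r \<subseteq> B" "walk R z r y" "val r = val (rev d @ v)"
      using walk_retractable[unfolded walk_retractable_def] B d(2) by meson
    have "val q \<otimes> val r = (val u \<otimes> val d) \<otimes> (inv (val d) \<otimes> val v)"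
      using q(3) r(3) uE dE vE by (simp add: val_rev)
    also have "\<dots> = val u \<otimes> (val d \<otimes> (inv (val d) \<otimes> val v))"
      using uE dE vE by (simp add: m_assoc)
    also have "\<dots> = val u \<otimes> val v"
      using uE dE vE by (simp add: m_assoc[symmetric])
    finally show thesis using that q(1,2) r(1,2) eq by metis
  next
    case False
    \<comment> \<open>Now the letters of \<open>v\<close> outside \<open>A\<close> never meet a
      vertex of the constraint graph and act trivially. Dropping them leaves a word over
      \<open>A \<inter> B\<close> from \<open>b\<close> to \<open>s y\<close>, a
      contradiction.\<close>
    define U where "U = {fold p d b | d. set d \<subseteq> A \<inter> B}"
    have U: "U \<subseteq> W" using acts_fold[OF acts_p _ b] A by (auto simp: U_def)
    have "fold p v b = fold p (filter (\<lambda>e. e \<in> A) v) b"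
    proof (rule fold_filter[where V=U])
      show "b \<in> U" by (auto simp: U_def intro!: exI[of _ "[]"])
      fix e g assume e: "e \<in> set v" and g: "g \<in> U"
      then obtain d where d: "g = fold p d b" "set d \<subseteq> A \<inter> B" by (auto simp: U_def)
      show "p e g \<in> U \<and> (e \<notin> A \<longrightarrow> p e g = g)"
      proof (cases "e \<in> A")
        case True
        then show ?thesis using d e v by (auto simp: U_def intro!: exI[of _ "d @ [e]"])
      next
        case out: False
        have "g \<in> W - s ` S" using U g d False by auto
        then have "p e g = g" using off out e vE by blast
        then show ?thesis using g by simp
      qed
    qed
    then have "fold p (filter (\<lambda>e. e \<in> A) v) b = s y" using bv by simp
    moreover have "set (filter (\<lambda>e. e \<in> A) v) \<subseteq> A \<inter> B" using v by auto
    ultimately show thesis using False yS by blast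
  qed
qed

end

end

section \<open>Raising the level\<close>

text \<open>A definition cannot quantify over types, so the points have the type that occurs in
  \<open>closed_product\<close>, pairs of a layer index and a group element; in
  \<open>completion_compatible\<close> it is that of \<open>completion_exists\<close>. The bound
  \<open>N\<close> on the number of layers keeps the chains of bounded size.\<close>

definition chain_compatible :: "nat \<Rightarrow> nat \<Rightarrow> 'e set \<Rightarrow> nat monoid \<Rightarrow> ('e \<Rightarrow> nat) \<Rightarrow> bool" where
  "chain_compatible N k E G \<iota> \<longleftrightarrow> (\<forall>n V \<beta> (p :: 'e \<Rightarrow> nat \<times> nat \<Rightarrow> nat \<times> nat).
     n \<le> N \<and> chain E G \<iota> n V \<beta> p \<and> (\<forall>i<n. card (\<beta> i) < k) \<longrightarrow> globally_compatible E G \<iota> (\<Union>i<n. V i) p)"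

definition completion_compatible ::
  "nat \<Rightarrow> 'e set \<Rightarrow> 'v set \<Rightarrow> ('e \<Rightarrow> ('v \<times> 'v) set) \<Rightarrow> nat monoid \<Rightarrow> ('e \<Rightarrow> nat) \<Rightarrow> bool" where
  "completion_compatible k E S R G \<iota> \<longleftrightarrow> (\<forall>A W (p :: 'e \<Rightarrow> ('v \<times> nat) set \<Rightarrow> ('v \<times> nat) set) s.
     completion E G \<iota> S R A W p s \<and> card A < k \<longrightarrow> globally_compatible E G \<iota> W p)"

text \<open>A chain refers to the group only through the triviality of words over a single
  \<open>\<beta> i\<close>. Similarly, a completion refers to it only through words over
  \<open>A\<close>.\<close>

lemma (in chain) chain_transfer:
  assumes "egrp E H \<kappa>"
    and ker: "\<And>i w. i < n \<Longrightarrow> set w \<subseteq> \<beta> i \<Longrightarrow> wval H \<kappa> w = \<one>\<^bsub>H\<^esub> \<longleftrightarrow> wval G \<iota> w = \<one>"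
  shows "chain E H \<kappa> n V \<beta> p"
proof -
  interpret H: egrp E H \<kappa> by fact
  show ?thesis
    by unfold_locales (use letters layer_acts fixed free orbit far overlap ker in auto)
qed

lemma (in completion) completion_transfer:
  assumes "egrp E H \<kappa>"
    and ker: "\<And>w. set w \<subseteq> A \<Longrightarrow> wval H \<kappa> w = \<one>\<^bsub>H\<^esub> \<longleftrightarrow> wval G \<iota> w = \<one>"
  shows "completion E H \<kappa> S R A W p s"
proof -
  interpret H: egrp E H \<kappa> by fact
  show ?thesis
  proof (unfold_locales, goal_cases)
    case (4 v w)
    then show ?case using trivial ker by blast
  next
    case (10 x y u)
    then obtain q where q: "set q \<subseteq> A" "walk R x q y" "val q = val u" using return by blast
    then have "val (q @ rev u) = \<one>" using val_eq_iff[of q u] 10 AE by auto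
    then have "H.val (q @ rev u) = \<one>\<^bsub>H\<^esub>" using ker[of "q @ rev u"] q 10 by auto
    then have "H.val q = H.val u" using H.val_eq_iff[of q u] 10 q AE by auto
    then show ?case using q by blast
  next
    case (11 v)
    then show ?case using generated by blast
  qed (use graph AE acts_p s_in s_inj other off real in auto)
qed

text \<open>Every structure over \<open>H\<close> to be controlled has letter sets with at most
  \<open>k\<close> members, on which \<open>H\<close> and \<open>G\<close> agree by
  \<open>ker\<close>. It is therefore a structure over \<open>G\<close>, where the hypotheses of
  level \<open>k\<close> make it locally compatible, and the expansion turns this into compatibility
  with \<open>H\<close>.\<close>

lemma raise_level:
  fixes G :: "nat monoid" and S :: "'v set" and R :: "'e \<Rightarrow> ('v \<times> 'v) set"
  assumes eg: "E_group E G \<iota>" and finE: "finite E" and finG: "finite (carrier G)"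
    and finS: "finite S" and graph: "E_graph E S R" and comp: "compatible E S R G \<iota>"
    and retr: "retractable E k G \<iota>" and ch: "chain_compatible N k E G \<iota>"
    and co: "completion_compatible k E S R G \<iota>"
  obtains H :: "nat monoid" and \<kappa> where "E_group E H \<kappa>" "finite (carrier H)"
    "\<And>w. set w \<subseteq> E \<Longrightarrow> wval H \<kappa> w = \<one>\<^bsub>H\<^esub> \<Longrightarrow> wval G \<iota> w = \<one>\<^bsub>G\<^esub>"
    "\<And>\<rho>. \<rho> permutes E \<Longrightarrow> symmetric_kernel E G \<iota> \<rho> \<Longrightarrow> symmetric_kernel E H \<kappa> \<rho>"
    "retractable E (Suc k) H \<kappa>" "chain_compatible N (Suc k) E H \<kappa>"
    "completion_compatible (Suc k) E S R H \<kappa>"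
proof -
  interpret egrp E G \<iota> by unfold_locales fact
  have eG: "egrp E G \<iota>" by unfold_locales
  \<comment> \<open>One summand for each kind of action: erasure acting on \<open>G\<close>, chains
    of at most \<open>N\<close> layers, and completions. Sizes are measured in \<open>G\<close>, so
    \<open>M\<close> is fixed before \<open>H\<close> exists.\<close>
  define M where "M = card (carrier G) + N * card (carrier G) + card S * card (carrier G)"
  obtain H :: "nat monoid" and \<kappa> where H: "E_group E H \<kappa>" "finite (carrier H)"
    and HG: "\<And>w. set w \<subseteq> E \<Longrightarrow> wval H \<kappa> w = \<one>\<^bsub>H\<^esub> \<Longrightarrow> val w = \<one>\<^bsub>G\<^esub>"
    and GH: "\<And>w. set w \<subseteq> E \<Longrightarrow> card (set w) \<le> k \<Longrightarrow> val w = \<one>\<^bsub>G\<^esub> \<Longrightarrow> wval H \<kappa> w = \<one>\<^bsub>H\<^esub>"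
    and small: "\<And>p :: 'e \<Rightarrow> nat \<Rightarrow> nat. acts E {..<M} p \<Longrightarrow> locally_compatible E k G \<iota> {..<M} p \<Longrightarrow>
       globally_compatible E H \<kappa> {..<M} p"
    and sym: "\<And>\<rho>. \<rho> permutes E \<Longrightarrow> symmetric_kernel E G \<iota> \<rho> \<Longrightarrow> symmetric_kernel E H \<kappa> \<rho>"
    using expansion[OF eg finE finG] by blast
  interpret H: egrp E H \<kappa> by unfold_locales fact
  have ker: "wval G \<iota> w = \<one>\<^bsub>G\<^esub> \<longleftrightarrow> wval H \<kappa> w = \<one>\<^bsub>H\<^esub>"
    if "B \<subseteq> E" "card B \<le> k" "set w \<subseteq> B" for B w
  proof -
    have "card (set w) \<le> k" using that card_mono[OF finite_subset[OF that(1) finE] that(3)] by simp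
    then show ?thesis using GH HG that by blast
  qed
  have "retractable E (Suc k) H \<kappa>"
    unfolding retractable_def
  proof (intro allI impI, elim conjE)
    fix A w assume A: "A \<subseteq> E" "card A < Suc k" and w: "set w \<subseteq> E" "H.val w = \<one>\<^bsub>H\<^esub>"
    \<comment> \<open>Under this action a word fixes the identity of \<open>G\<close> exactly when
      it becomes trivial after erasing the letters outside \<open>A\<close>.\<close>
    define p where "p e x = (if e \<in> A then x \<otimes>\<^bsub>G\<^esub> \<iota> e else x)" for e x
    have acts: "acts E (carrier G) p" using acts_right_mult by (auto simp: acts_def p_def)
    have fold_p: "fold p u x = x \<otimes>\<^bsub>G\<^esub> val (filter (\<lambda>e. e \<in> A) u)"
      if "set u \<subseteq> E" "x \<in> carrier G" for u x
    proof -
      have "fold p u x = fold (\<lambda>e x. x \<otimes>\<^bsub>G\<^esub> \<iota> e) (filter (\<lambda>e. e \<in> A) u) x"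
        by (induction u arbitrary: x) (auto simp: p_def)
      also have "set (filter (\<lambda>e. e \<in> A) u) \<subseteq> E" using that by auto
      then have "fold (\<lambda>e x. x \<otimes>\<^bsub>G\<^esub> \<iota> e) (filter (\<lambda>e. e \<in> A) u) x = x \<otimes>\<^bsub>G\<^esub> val (filter (\<lambda>e. e \<in> A) u)"
        using that fold_right_mult by blast
      finally show ?thesis .
    qed
    have "locally_compatible E k G \<iota> (carrier G) p"
      unfolding locally_compatible_def
    proof (intro allI impI ballI, elim conjE)
      fix u x assume u: "set u \<subseteq> E" "card (set u) \<le> k" "val u = \<one>\<^bsub>G\<^esub>" and x: "x \<in> carrier G"
      have "val (filter (\<lambda>e. e \<in> A) u) = \<one>\<^bsub>G\<^esub>"
      proof (cases "set u \<subseteq> A")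
        case True
        then have "filter (\<lambda>e. e \<in> A) u = u" by (auto simp: filter_id_conv)
        then show ?thesis using u by simp
      next
        case False
        \<comment> \<open>\<open>A\<close> may have \<open>k\<close> members, too many for
          \<open>retr\<close>; but for \<open>u\<close> only \<open>A \<inter> set u\<close>
          matters, which is smaller.\<close>
        then have "A \<inter> set u \<subset> set u" by blast
        then have "card (A \<inter> set u) < k" using psubset_card_mono[of "set u" "A \<inter> set u"] u by simp
        moreover have "A \<inter> set u \<subseteq> E" using A by blast
        ultimately have "val (filter (\<lambda>e. e \<in> A \<inter> set u) u) = \<one>\<^bsub>G\<^esub>"
          using retr u unfolding retractable_def by blast
        moreover have "filter (\<lambda>e. e \<in> A \<inter> set u) u = filter (\<lambda>e. e \<in> A) u" by (auto intro!: filter_cong)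
        ultimately show ?thesis by simp
      qed
      then show "fold p u x = x" using fold_p u x by simp
    qed
    then have "globally_compatible E H \<kappa> (carrier G) p"
      using compatible_of_small[OF small finG _ acts] by (simp add: M_def)
    then have "fold p w \<one>\<^bsub>G\<^esub> = \<one>\<^bsub>G\<^esub>" using w unfolding globally_compatible_def by blast
    moreover have wA: "set (filter (\<lambda>e. e \<in> A) w) \<subseteq> A" by auto
    ultimately have "val (filter (\<lambda>e. e \<in> A) w) = \<one>\<^bsub>G\<^esub>"
      using fold_p[of w "\<one>\<^bsub>G\<^esub>"] w A val_closed[of "filter (\<lambda>e. e \<in> A) w"] by auto
    then show "H.val (filter (\<lambda>e. e \<in> A) w) = \<one>\<^bsub>H\<^esub>" using ker[of A] A wA by auto
  qed
  moreover have "chain_compatible N (Suc k) E H \<kappa>"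
    unfolding chain_compatible_def
  proof (intro allI impI, elim conjE)
    fix n V \<beta> and p :: "'e \<Rightarrow> nat \<times> nat \<Rightarrow> nat \<times> nat"
    assume n: "n \<le> N" and c: "chain E H \<kappa> n V \<beta> p" and \<beta>: "\<forall>i<n. card (\<beta> i) < Suc k"
    interpret h: chain E H \<kappa> n V \<beta> p by (rule c)
    have "chain E G \<iota> n V \<beta> p"
      by (rule h.chain_transfer[OF eG], rule ker[OF h.letters]) (use \<beta> in auto)
    then interpret c: chain E G \<iota> n V \<beta> p .
    have "locally_compatible E k G \<iota> (\<Union>i<n. V i) p"
      using ch n unfolding chain_compatible_def by (intro c.locally_compatible_chain[OF finE retr]) blast
    moreover have "card (\<Union>i<n. V i) \<le> M"
      using c.card_all[OF finG] mult_le_mono1[OF n, of "card (carrier G)"] unfolding M_def by linarith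
    ultimately show "globally_compatible E H \<kappa> (\<Union>i<n. V i) p"
      using compatible_of_small[OF small _ _ c.acts_all] c.card_all[OF finG] by blast
  qed
  moreover have "completion_compatible (Suc k) E S R H \<kappa>"
    unfolding completion_compatible_def
  proof (intro allI impI, elim conjE)
    fix A W s and p :: "'e \<Rightarrow> ('v \<times> nat) set \<Rightarrow> ('v \<times> nat) set"
    assume c: "completion E H \<kappa> S R A W p s" and A: "card A < Suc k"
    interpret h: completion E H \<kappa> S R A W p s by (rule c)
    have "completion E G \<iota> S R A W p s"
      by (rule h.completion_transfer[OF eG], rule ker[OF h.AE]) (use A in auto)
    then interpret c: completion E G \<iota> S R A W p s .
    have wr: "walk_retractable E k S R G \<iota>"
      by (rule walk_retractable[OF graph comp]) (use co in \<open>auto simp: completion_compatible_def\<close>)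
    have "locally_compatible E k G \<iota> W p"
      by (rule c.locally_compatible_completion[OF finE retr wr])
        (use A co in \<open>auto simp: completion_compatible_def\<close>)
    moreover have "card W \<le> M" using c.card_completion[OF finS finG] by (simp add: M_def)
    ultimately show "globally_compatible E H \<kappa> W p"
      using compatible_of_small[OF small _ _ c.acts_p] c.card_completion[OF finS finG] by blast
  qed
  ultimately show thesis using that[OF H HG sym] by blast
qed

section \<open>Coset cycles\<close>

context egrp
begin

lemma mult_inv_cancel: "x \<in> carrier G \<Longrightarrow> y \<in> carrier G \<Longrightarrow> x \<otimes> (inv x \<otimes> y) = y"
  by (simp add: m_assoc[symmetric])

text \<open>If no \<open>w i\<close> were such a product, the cosets \<open>g i G[\<alpha> i]\<close> could be glued consecutively into a
  chain, in which the trivial word \<open>w 0 \<dots> w (n - 1)\<close> would lead from the first to the last layer.\<close>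

lemma closed_product:
  assumes chains: "\<And>V \<beta> (p :: 'e \<Rightarrow> nat \<times> 'g \<Rightarrow> nat \<times> 'g). chain E G \<iota> n V \<beta> p \<Longrightarrow>
      (\<And>i. i < n \<Longrightarrow> card (\<beta> i) < k) \<Longrightarrow> globally_compatible E G \<iota> (\<Union>i<n. V i) p"
    and n: "2 \<le> n" and g: "\<And>i. i < n \<Longrightarrow> g i \<in> carrier G"
    and \<alpha>: "\<And>i. i < n \<Longrightarrow> \<alpha> i \<subseteq> E" "\<And>i. i < n \<Longrightarrow> card (\<alpha> i) < k"
    and w: "\<And>i. i < n \<Longrightarrow> set (w i) \<subseteq> \<alpha> i"
    and gw: "\<And>i. i < n \<Longrightarrow> g ((i + 1) mod n) = g i \<otimes> val (w i)"
  obtains i u v where "i < n" "set u \<subseteq> \<alpha> i \<inter> \<alpha> ((i + n - 1) mod n)"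
    "set v \<subseteq> \<alpha> i \<inter> \<alpha> ((i + 1) mod n)" "val (w i) = val u \<otimes> val v"
proof (rule ccontr)
  assume "\<not> thesis"
  then have sep: "val (w i) \<noteq> val u \<otimes> val v" if "i < n" "set u \<subseteq> \<alpha> i \<inter> \<alpha> ((i + n - 1) mod n)"
    "set v \<subseteq> \<alpha> i \<inter> \<alpha> ((i + 1) mod n)" for i u v
    using that \<open>\<And>v u i. i < n \<Longrightarrow> set u \<subseteq> \<alpha> i \<inter> \<alpha> ((i + n - 1) mod n) \<Longrightarrow>
      set v \<subseteq> \<alpha> i \<inter> \<alpha> ((i + 1) mod n) \<Longrightarrow> val (w i) = val u \<otimes> val v \<Longrightarrow> thesis\<close> by blast
  have wE: "set z \<subseteq> E" if "i < n" "set z \<subseteq> \<alpha> i" for i z using that \<alpha>(1) by blast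
  have gS: "g (Suc i) = g i \<otimes> val (w i)" if "Suc i < n" for i using gw[of i] that by simp
  \<comment> \<open>\<open>P i\<close> becomes layer \<open>i\<close>, and \<open>Q j\<close> is
    where layer \<open>j\<close> is glued to layer \<open>j - 1\<close>. By truncated subtraction
    \<open>Q 0\<close> describes no gluing, whence the guards \<open>0 < i\<close> below.\<close>
  define P where "P i = {g i \<otimes> val z | z. set z \<subseteq> \<alpha> i}" for i
  define Q where "Q j = {g j \<otimes> val z | z. set z \<subseteq> \<alpha> (j - 1) \<inter> \<alpha> j}" for j
  have Xc: "x \<in> carrier G" if "i < n" "x \<in> P i" for x i
    using that g wE by (auto simp: P_def)
  have X_mult: "x \<otimes> val z \<in> P i" if xi: "i < n" "x \<in> P i" "set z \<subseteq> \<alpha> i" for x i z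
  proof -
    obtain y where "x = g i \<otimes> val y" "set y \<subseteq> \<alpha> i" using xi by (auto simp: P_def)
    then have "x \<otimes> val z = g i \<otimes> val (y @ z)" "set (y @ z) \<subseteq> \<alpha> i"
      using xi wE[OF xi(1)] g by (auto simp: m_assoc)
    then show ?thesis unfolding P_def by blast
  qed
  have QX: "Q j \<subseteq> P j" for j by (auto simp: Q_def P_def)
  have QX': "Q (Suc i) \<subseteq> P i" if "Suc i < n" for i
  proof
    fix x assume "x \<in> Q (Suc i)"
    then obtain z where z: "x = g (Suc i) \<otimes> val z" "set z \<subseteq> \<alpha> i \<inter> \<alpha> (Suc i)" by (auto simp: Q_def)
    have "g i \<in> P i" using g that by (auto simp: P_def intro!: exI[of _ "[]"])
    then have "g i \<otimes> val (w i) \<otimes> val z \<in> P i" using X_mult z w that by auto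
    then show "x \<in> P i" using z gS[OF that] by simp
  qed
  have Q_mult: "x \<otimes> val z \<in> Q j" if xj: "j < n" "x \<in> Q j" "set z \<subseteq> \<alpha> (j - 1) \<inter> \<alpha> j" for x j z
  proof -
    obtain y where "x = g j \<otimes> val y" "set y \<subseteq> \<alpha> (j - 1) \<inter> \<alpha> j" using xj by (auto simp: Q_def)
    then have "x \<otimes> val z = g j \<otimes> val (y @ z)" "set (y @ z) \<subseteq> \<alpha> (j - 1) \<inter> \<alpha> j"
      using xj wE[OF xj(1)] g by (auto simp: m_assoc)
    then show ?thesis unfolding Q_def by blast
  qed
  have Q_coset: "\<exists>z. set z \<subseteq> \<alpha> (j - 1) \<inter> \<alpha> j \<and> y = x \<otimes> val z"
    if xy: "j < n" "x \<in> Q j" "y \<in> Q j" for x y j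
  proof -
    obtain a b where ab: "x = g j \<otimes> val a" "set a \<subseteq> \<alpha> (j - 1) \<inter> \<alpha> j"
      "y = g j \<otimes> val b" "set b \<subseteq> \<alpha> (j - 1) \<inter> \<alpha> j" using xy by (auto simp: Q_def)
    have abE: "set a \<subseteq> E" "set b \<subseteq> E" using ab wE[OF xy(1)] by auto
    have "x \<otimes> val (rev a @ b) = g j \<otimes> (val a \<otimes> (inv (val a) \<otimes> val b))"
      unfolding ab(1) using abE g[OF xy(1)] by (simp add: val_rev m_assoc)
    then have "x \<otimes> val (rev a @ b) = y" using ab abE by (simp add: mult_inv_cancel)
    then show ?thesis using ab by (intro exI[of _ "rev a @ b"]) auto
  qed
  have Qsep: "g i \<otimes> val a \<notin> Q (Suc i)" if i: "Suc i < n" and a: "set a \<subseteq> \<alpha> i \<inter> \<alpha> ((i + n - 1) mod n)" for i a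
  proof
    assume "g i \<otimes> val a \<in> Q (Suc i)"
    then obtain b where b: "g i \<otimes> val a = g (Suc i) \<otimes> val b" "set b \<subseteq> \<alpha> i \<inter> \<alpha> (Suc i)" by (auto simp: Q_def)
    have E: "set a \<subseteq> E" "set b \<subseteq> E" "set (w i) \<subseteq> E" using a b wE[of i] w[of i] i by auto
    have "g i \<otimes> val a = g i \<otimes> (val (w i) \<otimes> val b)"
      using b(1) gS[OF i] E g[of i] i by (simp add: m_assoc)
    then have "val a = val (w i) \<otimes> val b" using E g[of i] i by simp
    then have "val (w i) = val a \<otimes> val (rev b)" using E by (simp add: val_rev inv_solve_right)
    then show False using sep[of i a "rev b"] a b i by auto
  qed
  \<comment> \<open>No point is glued on both sides, hence none lies in three layers.\<close>
  have disj: "Q i \<inter> Q (Suc i) = {}" if i: "0 < i" "Suc i < n" for i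
  proof -
    have "(i + n - 1) mod n = i - 1" using i by (simp add: mod_if)
    then show ?thesis using Qsep[OF i(2)] by (auto simp: Q_def[of i])
  qed
  have start: "g 0 \<notin> Q 1" using Qsep[of 0 "[]"] n g[of 0] by simp
  \<comment> \<open>The name of the point \<open>x\<close> of layer \<open>i\<close>: a glued point
    carries the index of the lower of its two layers. By \<open>disj\<close> both layers give it the
    same name.\<close>
  define rep where "rep i x = (if 0 < i \<and> x \<in> Q i then (i - 1, x) else (i, x))" for i x
  define p where "p e c = (case c of (j, x) \<Rightarrow>
     if j < n \<and> x \<in> P j \<and> e \<in> \<alpha> j then rep j (x \<otimes> \<iota> e)
     else if Suc j < n \<and> x \<in> Q (Suc j) \<and> e \<in> \<alpha> (Suc j) then rep (Suc j) (x \<otimes> \<iota> e) else c)" for e c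
  define V where "V i = rep i ` P i" for i
  have link: "rep (Suc i) x = rep i x" if "Suc i < n" "x \<in> Q (Suc i)" for i x
    using that disj[of i] by (auto simp: rep_def)
  have rep_less: "x = y \<and> j = Suc i \<and> x \<in> Q j" if "rep i x = rep j y" "i < j" for i j x y
    using that by (auto simp: rep_def split: if_splits)
  have rep_inj: "x = y" if "rep i x = rep j y" for i j x y
    using that by (auto simp: rep_def split: if_splits)
  have p_rep: "p e (rep i x) = rep i (x \<otimes> \<iota> e)" if i: "i < n" and x: "x \<in> P i" and e: "e \<in> \<alpha> i" for e i x
  proof (cases "0 < i \<and> x \<in> Q i")
    case False
    then have "rep i x = (i, x)" unfolding rep_def by (rule if_not_P)
    then show ?thesis using i x e by (simp add: p_def)
  next
    case True
    then obtain j where j: "i = Suc j" by (cases i) auto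
    have r: "rep i x = (j, x)" using True j by (simp add: rep_def)
    have xj: "x \<in> P j" using QX'[of j] True j i by auto
    show ?thesis
    proof (cases "e \<in> \<alpha> j")
      case True
      have "x \<otimes> val [e] \<in> Q i" using Q_mult[of i x "[e]"] True \<open>0 < i \<and> x \<in> Q i\<close> i j e by auto
      moreover have "val [e] = \<iota> e" using gen_closed \<alpha>(1)[OF i] e by auto
      ultimately have "x \<otimes> \<iota> e \<in> Q (Suc j)" using j by simp
      then show ?thesis using r xj True link[of j "x \<otimes> \<iota> e"] i j by (simp add: p_def)
    next
      case False
      then show ?thesis using r \<open>0 < i \<and> x \<in> Q i\<close> i j e by (simp add: p_def)
    qed
  qed
  have X_gen: "x \<otimes> \<iota> e \<in> P i" if "i < n" "x \<in> P i" "e \<in> \<alpha> i" for i x e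
    using X_mult[of i x "[e]"] that gen_closed \<alpha>(1)[of i] by auto
  have fold_rep: "fold p u (rep i x) = rep i (x \<otimes> val u)" if "i < n" "x \<in> P i" "set u \<subseteq> \<alpha> i" for u i x
    using that
  proof (induction u arbitrary: x)
    case Nil
    then show ?case using Xc by simp
  next
    case (Cons e u)
    then have "\<iota> e \<in> carrier G" "val u \<in> carrier G" using \<alpha>(1)[of i] gen_closed wE[of i u] by auto
    then show ?case using Cons Xc X_gen by (simp add: p_rep m_assoc)
  qed
  have "chain E G \<iota> n V \<alpha> p"
  proof (unfold_locales, goal_cases)
    case (1 i)
    then show ?case using \<alpha>(1) by blast
  next
    case (2 i)
    show ?case
      unfolding acts_def
    proof (intro ballI)
      fix e v assume e: "e \<in> \<alpha> i" and "v \<in> V i"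
      then obtain x where x: "x \<in> P i" "v = rep i x" by (auto simp: V_def)
      have eE: "e \<in> E" using e 2 \<alpha>(1) by blast
      have "x \<otimes> \<iota> e \<otimes> \<iota> e = x" using Xc[OF 2 x(1)] gen_closed[OF eE] gen_sq[OF eE] by (simp add: m_assoc)
      then show "p e v \<in> V i \<and> p e (p e v) = v"
        using x e p_rep[OF 2] X_gen[OF 2] by (auto simp: V_def)
    qed
  next
    case (3 i v e)
    obtain x where x: "x \<in> P i" "v = rep i x" using 3 by (auto simp: V_def)
    have "\<exists>j. v = (j, x)" by (simp add: x(2) rep_def)
    then obtain j where v: "v = (j, x)" by blast
    have vj: "v \<in> V j" if "j < n" "x \<in> P j"
    proof (cases "i = j")
      case False
      then have ij: "i = Suc j" "x \<in> Q i" using x v by (auto simp: rep_def split: if_splits)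
      then have "v = rep j x" using link[of j x] x 3(1) by simp
      then show ?thesis using that by (auto simp: V_def)
    qed (use 3 in simp)
    have vs: "v \<in> V (Suc j)" if "Suc j < n" "x \<in> Q (Suc j)"
    proof -
      have "rep (Suc j) x = v" using that v by (simp add: rep_def)
      then show ?thesis using QX that by (auto simp: V_def)
    qed
    show ?case using v vj vs 3(4) by (auto simp: p_def)
  next
    case (4 i v u)
    then obtain x where x: "x \<in> P i" "v = rep i x" by (auto simp: V_def)
    have "fold p u v = v \<longleftrightarrow> x \<otimes> val u = x"
      using fold_rep[OF 4(1) x(1) 4(3)] x rep_inj[of i "x \<otimes> val u" i x] by auto
    then show ?case using mult_eq_self Xc[OF 4(1) x(1)] wE[OF 4(1,3)] by simp
  next
    case (5 i a b)
    then obtain x y where xy: "x \<in> P i" "a = rep i x" "y \<in> P i" "b = rep i y" by (auto simp: V_def)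
    obtain c d where cd: "x = g i \<otimes> val c" "set c \<subseteq> \<alpha> i" "y = g i \<otimes> val d" "set d \<subseteq> \<alpha> i"
      using xy by (auto simp: P_def)
    have cdE: "set c \<subseteq> E" "set d \<subseteq> E" using cd wE[OF 5(1)] by auto
    have "x \<otimes> val (rev c @ d) = g i \<otimes> (val c \<otimes> (inv (val c) \<otimes> val d))"
      unfolding cd(1) using cdE g[OF 5(1)] by (simp add: val_rev m_assoc)
    then have "x \<otimes> val (rev c @ d) = y" using cd cdE by (simp add: mult_inv_cancel)
    moreover have "set (rev c @ d) \<subseteq> \<alpha> i" using cd by auto
    ultimately show ?case using fold_rep[OF 5(1) xy(1)] xy by metis
  next
    case (6 i j)
    show ?case
    proof (rule equals0I)
      fix v assume "v \<in> V i \<inter> V j"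
      then obtain x y where "rep i x = rep j y" by (auto simp: V_def)
      then show False using rep_less[of i x j y] 6 by auto
    qed
  next
    case (7 i a b)
    have *: "\<exists>x. a = rep i x \<and> x \<in> Q (Suc i)" if a: "a \<in> V i \<inter> V (Suc i)" for a
    proof -
      obtain x y where "a = rep i x" "a = rep (Suc i) y" using a unfolding V_def by blast
      then show ?thesis using rep_less[of i x "Suc i" y] by auto
    qed
    obtain x y where xy: "a = rep i x" "x \<in> Q (Suc i)" "b = rep i y" "y \<in> Q (Suc i)"
      using * 7 by meson
    obtain z where z: "set z \<subseteq> \<alpha> i \<inter> \<alpha> (Suc i)" "y = x \<otimes> val z"
      using Q_coset[OF 7(1) xy(2,4)] by auto
    have "fold p z a = b" using fold_rep[of i x z] xy z QX'[OF 7(1)] 7(1) by auto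
    then show ?case using z by blast
  qed
  then have compat: "globally_compatible E G \<iota> (\<Union>i<n. V i) p" using chains \<alpha>(2) by blast
  \<comment> \<open>The prefix \<open>w 0 \<dots> w (m - 1)\<close> climbs from \<open>g 0\<close>
    in the lowest layer to \<open>g m\<close> in layer \<open>m\<close>, since each
    \<open>w i\<close> ends in the gluing coset \<open>Q (Suc i)\<close>.\<close>
  have walk: "set (concat (map w [0..<m])) \<subseteq> E \<and> g 0 \<otimes> val (concat (map w [0..<m])) = g m \<and>
     fold p (concat (map w [0..<m])) (rep 0 (g 0)) = rep m (g m)" if "m < n" for m
    using that
  proof (induction m)
    case 0
    then show ?case using g by simp
  next
    case (Suc m)
    have E: "set (w m) \<subseteq> E" "set (concat (map w [0..<m])) \<subseteq> E"
      using Suc wE[of m "w m"] w[of m] by auto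
    have gm: "g m \<in> P m" using g Suc by (auto simp: P_def intro!: exI[of _ "[]"])
    have "g (Suc m) \<in> Q (Suc m)" using g Suc by (auto simp: Q_def intro!: exI[of _ "[]"])
    then have "fold p (w m) (rep m (g m)) = rep (Suc m) (g (Suc m))"
      using fold_rep[of m "g m" "w m"] gm Suc w link gS by simp
    moreover have "g 0 \<otimes> (val (concat (map w [0..<m])) \<otimes> val (w m)) = g (Suc m)"
      using Suc E g[of 0] gS by (simp add: m_assoc[symmetric])
    ultimately show ?case using Suc E by simp
  qed
  define l where "l = n - 1"
  have l: "l < n" "(l + 1) mod n = 0" "0 < l" using n by (auto simp: l_def)
  \<comment> \<open>The last word stays in layer \<open>l\<close>, which is not glued back to layer
    \<open>0\<close>: the product closes up in \<open>G\<close>, but not in the chain.\<close>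
  define u where "u = concat (map w [0..<l]) @ w l"
  have E: "set (concat (map w [0..<l])) \<subseteq> E" "set (w l) \<subseteq> E"
    using walk[OF l(1)] wE[OF l(1) w[OF l(1)]] by auto
  have "g 0 \<otimes> val u = g 0 \<otimes> val (concat (map w [0..<l])) \<otimes> val (w l)"
    using E g[of 0] l by (simp add: u_def m_assoc)
  then have "g 0 \<otimes> val u = g 0" using walk[OF l(1)] gw[OF l(1)] l by simp
  moreover have uE: "set u \<subseteq> E" using E by (simp add: u_def)
  ultimately have "val u = \<one>" using mult_eq_self g[of 0] l by simp
  moreover have "rep 0 (g 0) \<in> (\<Union>i<n. V i)"
    using l g[of 0] by (intro UN_I[of 0]) (auto simp: V_def P_def intro!: imageI exI[of _ "[]"])
  ultimately have "fold p u (rep 0 (g 0)) = rep 0 (g 0)"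
    using compat uE unfolding globally_compatible_def by blast
  moreover have "g l \<in> P l" using g l by (auto simp: P_def intro!: exI[of _ "[]"])
  then have "fold p u (rep 0 (g 0)) = rep l (g 0)"
    using walk[OF l(1)] fold_rep[of l "g l" "w l"] w l gw[OF l(1)] by (simp add: u_def)
  ultimately have "rep 0 (g 0) = rep l (g 0)" by simp
  \<comment> \<open>Equal names force \<open>l = 1\<close> and \<open>g 0 \<in> Q 1\<close>; so for
    \<open>n = 2\<close>, where the two layers do meet, it is \<open>start\<close> that gives the
    contradiction.\<close>
  then show False using rep_less[of 0 "g 0" l "g 0"] l start by auto
qed

end

section \<open>Iterating the levels, and acyclicity at the last one\<close>

lemma exists_level:
  fixes E :: "'e set" and S :: "'v set" and R :: "'e \<Rightarrow> ('v \<times> 'v) set"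
    and G :: "('g, 'b) monoid_scheme"
  assumes finE: "finite E" and graph: "E_graph E S R" and finS: "finite S"
    and eg: "E_group E G \<iota>" and finG: "finite (carrier G)" and comp: "compatible E S R G \<iota>"
  shows "\<exists>(H :: nat monoid) \<kappa>. E_group E H \<kappa> \<and> finite (carrier H) \<and>
    (\<forall>w. set w \<subseteq> E \<and> wval H \<kappa> w = \<one>\<^bsub>H\<^esub> \<longrightarrow> wval G \<iota> w = \<one>\<^bsub>G\<^esub>) \<and>
    (\<forall>\<rho>. \<rho> permutes E \<and> symmetric_kernel E G \<iota> \<rho> \<longrightarrow> symmetric_kernel E H \<kappa> \<rho>) \<and>
    retractable E k H \<kappa> \<and> chain_compatible N k E H \<kappa> \<and> completion_compatible k E S R H \<kappa>"
proof (induction k)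
  case 0
  interpret egrp E G \<iota> by unfold_locales fact
  \<comment> \<open>At level \<open>0\<close> the invariants are void; it remains to copy
    \<open>G\<close> to the carrier type \<open>nat\<close>, by means of its regular action.\<close>
  obtain H :: "nat monoid" and \<kappa> where H: "E_group E H \<kappa>" "finite (carrier H)"
    and ker: "\<And>w. set w \<subseteq> E \<Longrightarrow> wval H \<kappa> w = \<one>\<^bsub>H\<^esub> \<longleftrightarrow>
      (\<forall>x\<in>carrier G. fold (\<lambda>e x. x \<otimes>\<^bsub>G\<^esub> \<iota> e) w x = x)"
  proof (rule group_of_action[OF finG acts_right_mult])
    show "\<exists>v\<in>carrier G. v \<otimes>\<^bsub>G\<^esub> \<iota> e \<noteq> v \<otimes>\<^bsub>G\<^esub> \<iota> f" if "e \<in> E" "f \<in> E" "e \<noteq> f" for e f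
      using that eg by (intro bexI[of _ "\<one>\<^bsub>G\<^esub>"]) (auto simp: gen_closed E_group_def inj_on_def)
    show "\<exists>v\<in>carrier G. v \<otimes>\<^bsub>G\<^esub> \<iota> e \<noteq> v" if "e \<in> E" for e
      using that eg by (intro bexI[of _ "\<one>\<^bsub>G\<^esub>"]) (auto simp: gen_closed E_group_def)
  qed blast
  have ker': "wval H \<kappa> w = \<one>\<^bsub>H\<^esub> \<longleftrightarrow> val w = \<one>\<^bsub>G\<^esub>" if "set w \<subseteq> E" for w
    using that ker[OF that] mult_eq_self by (auto simp: fold_right_mult)
  have "symmetric_kernel E H \<kappa> \<rho>" if \<rho>: "\<rho> permutes E" "symmetric_kernel E G \<iota> \<rho>" for \<rho>
    unfolding symmetric_kernel_def
  proof (intro allI impI)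
    fix w assume w: "set w \<subseteq> E"
    have "set (map \<rho> w) \<subseteq> E" using w permutes_in_image[OF \<rho>(1)] by auto
    then show "wval H \<kappa> w = \<one>\<^bsub>H\<^esub> \<longleftrightarrow> wval H \<kappa> (map \<rho> w) = \<one>\<^bsub>H\<^esub>"
      using \<rho>(2) w ker' unfolding symmetric_kernel_def by blast
  qed
  moreover have "chain_compatible N 0 E H \<kappa>"
    unfolding chain_compatible_def globally_compatible_def by auto
  ultimately show ?case
    using H ker' by (intro exI[of _ H] exI[of _ \<kappa>]) (auto simp: retractable_def completion_compatible_def)
next
  case (Suc k)
  then obtain K :: "nat monoid" and \<kappa> where K: "E_group E K \<kappa>" "finite (carrier K)"
    and ker: "\<And>w. set w \<subseteq> E \<Longrightarrow> wval K \<kappa> w = \<one>\<^bsub>K\<^esub> \<Longrightarrow> wval G \<iota> w = \<one>\<^bsub>G\<^esub>"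
    and sym: "\<And>\<rho>. \<rho> permutes E \<Longrightarrow> symmetric_kernel E G \<iota> \<rho> \<Longrightarrow> symmetric_kernel E K \<kappa> \<rho>"
    and level: "retractable E k K \<kappa>" "chain_compatible N k E K \<kappa>" "completion_compatible k E S R K \<kappa>"
    by blast
  have "compatible E S R K \<kappa>" using comp ker unfolding compatible_def by blast
  then obtain H :: "nat monoid" and \<mu> where H: "E_group E H \<mu>" "finite (carrier H)"
    "\<And>w. set w \<subseteq> E \<Longrightarrow> wval H \<mu> w = \<one>\<^bsub>H\<^esub> \<Longrightarrow> wval K \<kappa> w = \<one>\<^bsub>K\<^esub>"
    "\<And>\<rho>. \<rho> permutes E \<Longrightarrow> symmetric_kernel E K \<kappa> \<rho> \<Longrightarrow> symmetric_kernel E H \<mu> \<rho>"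
    "retractable E (Suc k) H \<mu>" "chain_compatible N (Suc k) E H \<mu>"
    "completion_compatible (Suc k) E S R H \<mu>"
    by (rule raise_level[OF K(1) finE K(2) finS graph _ level]) blast
  then show ?case using ker sym by (intro exI[of _ H] exI[of _ \<mu>]) blast
qed

text \<open>The letter sets of a cycle are proper, so the invariants of level \<open>card E\<close>
  cover them. \<open>closed_product\<close> finds a connecting word that factors in
  \<open>G\<close>; \<open>walk_product\<close> then makes the two factors label walks, and their
  common vertex gives an element in both of the cosets that should be separated.\<close>

lemma N_acyclic_of_level:
  fixes H :: "nat monoid" and S :: "'v set" and R :: "'e \<Rightarrow> ('v \<times> 'v) set"
  assumes eg: "E_group E H \<kappa>" and finE: "finite E" and graph: "E_graph E S R"
    and comp: "compatible E S R H \<kappa>" and ch: "chain_compatible N (card E) E H \<kappa>"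
    and co: "completion_compatible (card E) E S R H \<kappa>"
  shows "N_acyclic N E S R H \<kappa>"
  unfolding N_acyclic_def
proof (intro conjI notI comp)
  interpret egrp E H \<kappa> by unfold_locales fact
  assume "\<exists>n g \<alpha> s. 2 \<le> n \<and> n \<le> N \<and> coset_cycle E S R H \<kappa> n g \<alpha> s"
  then obtain n g \<alpha> s where n: "2 \<le> n" "n \<le> N" and cyc: "coset_cycle E S R H \<kappa> n g \<alpha> s" by blast
  have g: "g i \<in> carrier H" and sS: "s i \<in> S" and \<alpha>: "\<alpha> i \<subset> E"
    and con: "\<exists>w. set w \<subseteq> \<alpha> i \<and> walk R (s i) w (s ((i + 1) mod n)) \<and>
      g ((i + 1) mod n) = g i \<otimes>\<^bsub>H\<^esub> val w"
    and sep: "coset H \<kappa> R (\<alpha> i \<inter> \<alpha> ((i + n - 1) mod n)) (s i) (g i) \<inter>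
      coset H \<kappa> R (\<alpha> i \<inter> \<alpha> ((i + 1) mod n)) (s ((i + 1) mod n)) (g ((i + 1) mod n)) = {}"
    if "i < n" for i
    using cyc that unfolding coset_cycle_def by blast+
  have small: "card B < card E" if "B \<subseteq> \<alpha> i" "i < n" for B i
    using \<alpha>[OF that(2)] that(1) psubset_card_mono[OF finE, of B] by blast
  from con obtain w where w: "\<And>i. i < n \<Longrightarrow> set (w i) \<subseteq> \<alpha> i"
    "\<And>i. i < n \<Longrightarrow> walk R (s i) (w i) (s ((i + 1) mod n))"
    "\<And>i. i < n \<Longrightarrow> g ((i + 1) mod n) = g i \<otimes>\<^bsub>H\<^esub> val (w i)"
    by metis
  obtain i u v where i: "i < n" and u: "set u \<subseteq> \<alpha> i \<inter> \<alpha> ((i + n - 1) mod n)"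
    and v: "set v \<subseteq> \<alpha> i \<inter> \<alpha> ((i + 1) mod n)" and eq: "val (w i) = val u \<otimes>\<^bsub>H\<^esub> val v"
  proof (rule closed_product[where k = "card E" and n = n and g = g and \<alpha> = \<alpha> and w = w])
    show "globally_compatible E H \<kappa> (\<Union>i<n. V i) p"
      if "chain E H \<kappa> n V \<beta> p" "\<And>i. i < n \<Longrightarrow> card (\<beta> i) < card E" for V \<beta> and p :: "'e \<Rightarrow> nat \<times> nat \<Rightarrow> nat \<times> nat"
      using ch n(2) that unfolding chain_compatible_def by blast
  qed (use n g psubset_imp_subset[OF \<alpha>] small[OF order_refl] w in auto)
  define A where "A = \<alpha> i \<inter> \<alpha> ((i + n - 1) mod n)"
  define B where "B = \<alpha> i \<inter> \<alpha> ((i + 1) mod n)"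
  have AB: "A \<subseteq> E" "B \<subseteq> E" "card A < card E" "card B < card E"
    using \<alpha>[OF i] small[OF _ i] by (auto simp: A_def B_def)
  have wE: "set (w i) \<subseteq> E" using w(1)[OF i] \<alpha>[OF i] by blast
  have completions: "globally_compatible E H \<kappa> W p" if "completion E H \<kappa> S R A W p s" "card A < card E"
    for A W s and p :: "'e \<Rightarrow> ('v \<times> nat) set \<Rightarrow> ('v \<times> nat) set"
    using co that unfolding completion_compatible_def by blast
  obtain q z r where q: "set q \<subseteq> A" "walk R (s i) q z" and r: "set r \<subseteq> B" "walk R z r (s ((i + 1) mod n))"
    and qr: "val (w i) = val q \<otimes>\<^bsub>H\<^esub> val r"
    by (rule walk_product[OF graph comp completions AB(1,3,2,4) wE sS[OF i] w(2)[OF i] _ _ eq])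
      (use u v in \<open>auto simp: A_def B_def\<close>)
  have E: "set q \<subseteq> E" "set r \<subseteq> E" using q r AB by auto
  \<comment> \<open>The common element is \<open>g i\<close> times \<open>val q\<close>; from the
    next member of the cycle it is reached by \<open>rev r\<close>.\<close>
  have "walk R (s ((i + 1) mod n)) (rev r) z" using walk_rev[OF graph E(2) r(2)] .
  moreover have "g ((i + 1) mod n) \<otimes>\<^bsub>H\<^esub> val (rev r) = g i \<otimes>\<^bsub>H\<^esub> val q"
    using w(3)[OF i] qr E g[OF i] by (simp add: val_rev m_assoc)
  ultimately have "g i \<otimes>\<^bsub>H\<^esub> val q \<in> coset H \<kappa> R B (s ((i + 1) mod n)) (g ((i + 1) mod n))"
    using r(1) unfolding coset_def by (metis (mono_tags, lifting) mem_Collect_eq set_rev)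
  moreover have "g i \<otimes>\<^bsub>H\<^esub> val q \<in> coset H \<kappa> R A (s i) (g i)"
    using q unfolding coset_def by blast
  ultimately show False using sep[OF i] by (auto simp: A_def B_def)
qed

section \<open>Symmetries as invariance of the trivial words\<close>

lemma symmetric_kernel_of_group_symmetry:
  assumes eg: "E_group E G \<iota>" and \<rho>: "\<rho> permutes E" and sym: "group_symmetry E G \<iota> \<rho>"
  shows "symmetric_kernel E G \<iota> \<rho>"
proof -
  interpret egrp E G \<iota> by unfold_locales fact
  obtain h where h: "h \<in> iso G G" "\<And>e. e \<in> E \<Longrightarrow> h (\<iota> e) = \<iota> (\<rho> e)"
    using sym unfolding group_symmetry_def by blast
  then have hom: "h \<in> hom G G" and inj: "inj_on h (carrier G)" by (auto simp: iso_def bij_betw_def)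
  have h1: "h \<one>\<^bsub>G\<^esub> = \<one>\<^bsub>G\<^esub>" using hom_one[OF hom] is_group by blast
  have val: "h (val w) = val (map \<rho> w)" if "set w \<subseteq> E" for w
    using that by (induction w) (auto simp: h1 h(2) hom_mult[OF hom] gen_closed)
  show ?thesis
    unfolding symmetric_kernel_def
  proof (intro allI impI)
    fix w assume w: "set w \<subseteq> E"
    have "val w = \<one>\<^bsub>G\<^esub> \<longleftrightarrow> h (val w) = h \<one>\<^bsub>G\<^esub>"
      using inj_on_eq_iff[OF inj, of "val w" "\<one>\<^bsub>G\<^esub>"] w by simp
    then show "val w = \<one>\<^bsub>G\<^esub> \<longleftrightarrow> val (map \<rho> w) = \<one>\<^bsub>G\<^esub>" using val[OF w] h1 by simp
  qed
qed

text \<open>One direction of \<open>symmetric_kernel\<close> makes relabelling a well-defined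
  endomorphism, the other makes it injective; it is onto because \<open>\<rho>\<close> permutes the
  letters.\<close>

lemma group_symmetry_of_symmetric_kernel:
  assumes eg: "E_group E G \<iota>" and \<rho>: "\<rho> permutes E" and sym: "symmetric_kernel E G \<iota> \<rho>"
  shows "group_symmetry E G \<iota> \<rho>"
proof -
  interpret egrp E G \<iota> by unfold_locales fact
  have map_val: "wval G (\<lambda>e. \<iota> (\<rho> e)) w = val (map \<rho> w)" for w
    by (induction w) (auto simp: wval_def)
  have in_E: "\<rho> e \<in> E \<longleftrightarrow> e \<in> E" for e using permutes_in_image[OF \<rho>] .
  have "(\<lambda>e. \<iota> (\<rho> e)) ` E \<subseteq> carrier G" using in_E gen_closed by auto
  moreover have "\<iota> (\<rho> e) \<otimes>\<^bsub>G\<^esub> \<iota> (\<rho> e) = \<one>\<^bsub>G\<^esub>" if "e \<in> E" for e using that in_E gen_sq by auto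
  moreover have "wval G (\<lambda>e. \<iota> (\<rho> e)) w = \<one>\<^bsub>G\<^esub>" if "set w \<subseteq> E" "val w = \<one>\<^bsub>G\<^esub>" for w
    using sym that unfolding symmetric_kernel_def by (simp add: map_val)
  ultimately obtain h where hom: "h \<in> hom G G"
    and "\<And>w. set w \<subseteq> E \<Longrightarrow> h (val w) = wval G (\<lambda>e. \<iota> (\<rho> e)) w"
    by (rule hom_of_words[OF eg is_group]) blast+
  then have h: "h (val w) = val (map \<rho> w)" if "set w \<subseteq> E" for w using that by (simp add: map_val)
  interpret h: group_hom G G h by unfold_locales (rule hom)
  have "inj_on h (carrier G)"
    unfolding h.inj_iff_trivial_ker kernel_def
  proof (intro subset_antisym subsetI)
    fix x assume "x \<in> {x \<in> carrier G. h x = \<one>\<^bsub>G\<^esub>}"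
    then obtain w where "set w \<subseteq> E" "x = val w" "h x = \<one>\<^bsub>G\<^esub>" using carrier_val by auto
    then show "x \<in> {\<one>\<^bsub>G\<^esub>}" using h sym unfolding symmetric_kernel_def by simp
  qed auto
  moreover have "h ` carrier G = carrier G"
  proof
    show "carrier G \<subseteq> h ` carrier G"
    proof
      fix x assume "x \<in> carrier G"
      then obtain w where w: "set w \<subseteq> E" "x = val w" using carrier_val by auto
      define u where "u = map (inv_into UNIV \<rho>) w"
      have "set u \<subseteq> E" using w permutes_in_image[OF permutes_inv[OF \<rho>]] by (auto simp: u_def)
      moreover have "map \<rho> u = w" using permutes_inverses(1)[OF \<rho>] by (simp add: u_def map_idI)
      ultimately show "x \<in> h ` carrier G" using h[of u] w by (metis image_eqI val_closed)
    qed
  qed auto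
  ultimately have "h \<in> iso G G" using hom by (auto simp: iso_def bij_betw_def)
  moreover have "h (\<iota> e) = \<iota> (\<rho> e)" if "e \<in> E" for e
    using h[of "[e]"] that in_E gen_closed by simp
  ultimately show ?thesis unfolding group_symmetry_def by blast
qed

theorem mainTheorem2:
  fixes E :: "'e set" and S :: "'v set" and R :: "'e \<Rightarrow> ('v \<times> 'v) set"
    and G :: "('g, 'b) monoid_scheme" and \<iota> :: "'e \<Rightarrow> 'g" and N :: nat
  assumes "finite E"
    and "E_graph E S R" and "finite S"
    and "E_group E G \<iota>" and "finite (carrier G)"
    and "compatible E S R G \<iota>"
    and "N \<ge> 2"
  shows "\<exists>(H :: nat monoid) \<kappa>. E_group E H \<kappa> \<and> finite (carrier H) \<and>
           E_hom_exists E H \<kappa> G \<iota> \<and> compatible E S R H \<kappa> \<and> N_acyclic N E S R H \<kappa> \<and>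
           (\<forall>\<rho>. \<rho> permutes E \<and> graph_symmetry E S R \<rho> \<and> group_symmetry E G \<iota> \<rho>
                 \<longrightarrow> group_symmetry E H \<kappa> \<rho>)"
proof -
  interpret egrp E G \<iota> by unfold_locales fact
  obtain H :: "nat monoid" and \<kappa> where H: "E_group E H \<kappa>" "finite (carrier H)"
    and ker: "\<And>w. set w \<subseteq> E \<Longrightarrow> wval H \<kappa> w = \<one>\<^bsub>H\<^esub> \<Longrightarrow> val w = \<one>\<^bsub>G\<^esub>"
    and sym: "\<And>\<rho>. \<rho> permutes E \<Longrightarrow> symmetric_kernel E G \<iota> \<rho> \<Longrightarrow> symmetric_kernel E H \<kappa> \<rho>"
    and level: "chain_compatible N (card E) E H \<kappa>" "completion_compatible (card E) E S R H \<kappa>"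
    using exists_level[OF assms(1-6), of "card E" N] by blast
  interpret H: egrp E H \<kappa> by unfold_locales (rule H(1))
  have "\<iota> ` E \<subseteq> carrier G" using gen_closed by blast
  then obtain h where hom: "h \<in> hom H G" and h: "\<And>w. set w \<subseteq> E \<Longrightarrow> h (H.val w) = val w"
    using hom_of_words[OF H(1) is_group, of \<iota>] gen_sq ker by blast
  have "h (\<kappa> e) = \<iota> e" if "e \<in> E" for e
    using h[of "[e]"] that gen_closed H.gen_closed by simp
  then have "E_hom_exists E H \<kappa> G \<iota>" using hom unfolding E_hom_exists_def by blast
  moreover have comp: "compatible E S R H \<kappa>" using assms(6) ker unfolding compatible_def by blast
  moreover have "N_acyclic N E S R H \<kappa>"
    by (rule N_acyclic_of_level[OF H(1) assms(1,2) comp level])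
  moreover have "group_symmetry E H \<kappa> \<rho>" if "\<rho> permutes E" "group_symmetry E G \<iota> \<rho>" for \<rho>
    using group_symmetry_of_symmetric_kernel[OF H(1) that(1)] sym[OF that(1)]
      symmetric_kernel_of_group_symmetry[OF assms(4) that] by blast
  ultimately show ?thesis using H by blast
qed

end
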